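(* Let $(X,d)$ be a compact metric space with a computable structure $\mathcal I$, and let $T:X\to X$ be such that $(X,T)$ is a constructive dynamical system. Let $x\in X$ and let $f:\mathbf N\to\mathbf R$ be monotone with $f(n)\to\infty$. Then the following hold (each inequality being asserted whenever the product on its right-hand side is not the indeterminate form $0\cdot\infty$). (1) If $\log n=o(f(n))$, then $K^f(x)\le \overline d_B(X)\, r^f(x)$. (2) If $f(n)=\log n$, then $K^{\log}(x)\le \overline d_B(X)\, r^{\log}(x)+1$. (3) Suppose $x$ belongs to the closure $\overline{O_{I(s_0)}}$ of the orbit $O_{I(s_0)}=\{T^k(I(s_0)):k\ge 0\}$ of some ideal point $I(s_0)$ ($I\in\mathcal I$, $s_0\in\Sigma$). If $\log n=o(f(n))$, then $K^f(x)\le \overline d_B\big(\overline{O_{I(s_0)}}\big)\, r^f(x)$; and $K^{\log}(x)\le \overline d_B\big(\overline{O_{I(s_0)}}\big)\, r^{\log}(x)+1$.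
   Context: All logarithms are in base 2. $K^{\log}$ and $r^{\log}$ denote $K^f$ and $r^f$ for $f(n)=\log n$. All indicators below take values in $[-\infty,+\infty]$. **Strings and algorithmic information content.** $\Sigma=\{0,1\}^*$ is the set of finite (possibly empty) binary strings, $|s|$ is the length of $s$. Let $c:\Sigma\to\mathbf N$ be the bijection $\emptyset\mapsto0,\ 0\mapsto1,\ 1\mapsto2,\ 00\mapsto3,\ 01\mapsto4,\dots$ (length-lexicographic order). For $s=s_0\dots s_{n-1}$ put $\hat s=s_0s_0s_1s_1\dots s_{n-1}s_{n-1}01$. Let $A_1,A_2,\dots$ be a recursive enumeration of all Turing machines (partial recursive functions $\Sigma\to\Sigma$). A machine $\mathcal U$ is universal if $\mathcal U(\widehat{c^{-1}(m)}\,p)=A_m(p)$ for all $m,p$. A universal machine $\mathcal U$ is fixed once and for all, and $AIC(s)=\min\{|p|:\mathcal U(p)=s\}$. For words over a finite alphabet $\{0,\dots,N-1\}$, $AIC$ is defined in the same way through a fixed computable bijective encoding of such words as elements of $\Sigma$. **Computable structures.** A computable interpretation on a metric space $(X,d)$ is a map $I:\Sigma\to X$ with dense image for which there is a total recursive $D:\Sigma\times\Sigma\times\mathbf N\to\mathbf Q$ with $|d(I(s_1),I(s_2))-D(s_1,s_2,n)|\le2^{-n}$ for all $s_1,s_2,n$. Points $I(s)$ are called ideal points. Two computable interpretations $I_1,I_2$ are equivalent if there is a total recursive $D^*:\Sigma\times\Sigma\times\mathbf N\to\mathbf Q$ with $|d(I_1(s_1),I_2(s_2))-D^*(s_1,s_2,n)|\le2^{-n}$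 for all $s_1,s_2,n$. A computable structure $\mathcal I$ on $X$ is an equivalence class of computable interpretations. **Constructive systems.** $T:X\to X$ is constructive if (i) it is a morphism: $T$ is uniformly continuous and for all $I,J\in\mathcal I$ there is a total recursive $D^*:\Sigma\times\Sigma\times\mathbf N\to\mathbf Q$ with $|d(T(I(s_1)),J(s_2))-D^*(s_1,s_2,n)|\le2^{-n}$ for all $s_1,s_2,n$; and (ii) it is effectively uniformly continuous: there is a total recursive $g:\mathbf N\to\mathbf N$ such that $d(x,y)<2^{-g(n)}$ implies $d(T(x),T(y))<2^{-n}$ for all $x,y,n$. Then $(X,T)$ is called a constructive dynamical system. **Orbit complexity.** For a finite open cover $\beta=\{B_0,\dots,B_{N-1}\}$ of $X$ let $\varphi_\beta(x)=\{\omega\in\{0,\dots,N-1\}^{\mathbf N}:T^n(x)\in B_{\omega(n)}\ \forall n\in\mathbf N\}$, and let $\omega^n$ be the word of the first $n$ digits of $\omega$. Put $$K^f(x,T,\beta)=\limsup_{n\to\infty}\ \min_{\omega\in\varphi_\beta(x)}\frac{AIC(\omega^n)}{f(n)},\qquad K^f(x)=K^f(x,T)=\sup_\beta K^f(x,T,\beta),$$ the supremum being over all finite open covers $\beta$ of $X$. **Maximum initial-condition sensitivity.** $B(n,x,\epsilon)=\{y\in X: d(T^i(y),T^i(x))\le\epsilon\ \text{for all}\ 0\le i\le n\}$; $B_r(x)$ is the open ball of center $x$ and radius $r$; $r(x,n,\epsilon)=\sup\{r: B_r(x)\subset B(n,x,\epsilon)\}$; $r^f_\epsilon(x)=\limsup_{n\to\infty}\frac{-\log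 r(x,n,\epsilon)}{f(n)}$; $r^f(x)=\sup_{\epsilon>0}r^f_\epsilon(x)$. **Box dimension.** $n_\delta(F)$ is the minimum number of balls of radius $\delta$ covering $F$, and $\overline d_B(F)=\limsup_{\delta\to0}\frac{\log n_\delta(F)}{-\log\delta}$. *)

theory Defs
  imports "HOL-Analysis.Analysis" "HOL-Library.Nat_Bijection" "HOL-Library.Landau_Symbols"
begin

section \<open>Partial recursive functions\<close>

text \<open>
  Kleene's partial recursive functions. \<open>computes r xs y\<close> means that the program \<open>r\<close>, run on the
  argument tuple \<open>xs\<close>, halts with value \<open>y\<close>. Recursion and minimisation act on the first argument.
\<close>

datatype recf =
    Zero
  | Succ
  | Proj nat
  | Comp recf "recf list"
  | PrimRec recf recf
  | Mu recf

inductive computes :: "recf \<Rightarrow> nat list \<Rightarrow> nat \<Rightarrow> bool" where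
  zero: "computes Zero xs 0"
| succ: "computes Succ [x] (Suc x)"
| proj: "i < length xs \<Longrightarrow> computes (Proj i) xs (xs ! i)"
| comp: "list_all2 (\<lambda>g y. computes g xs y) gs ys \<Longrightarrow> computes f ys z \<Longrightarrow> computes (Comp f gs) xs z"
| prim_zero: "computes f xs z \<Longrightarrow> computes (PrimRec f g) (0 # xs) z"
| prim_suc: "computes (PrimRec f g) (n # xs) y \<Longrightarrow> computes g (n # y # xs) z
    \<Longrightarrow> computes (PrimRec f g) (Suc n # xs) z"
| mu: "computes f (n # xs) 0 \<Longrightarrow> (\<forall>i<n. \<exists>y. computes f (i # xs) (Suc y)) \<Longrightarrow> computes (Mu f) xs n"

definition partial_recursive :: "nat \<Rightarrow> (nat list \<Rightarrow> nat option) \<Rightarrow> bool" where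
  "partial_recursive k F \<longleftrightarrow>
    (\<exists>r. \<forall>xs. length xs = k \<longrightarrow> (\<forall>y. computes r xs y \<longleftrightarrow> F xs = Some y))"

definition total_recursive :: "nat \<Rightarrow> (nat list \<Rightarrow> nat) \<Rightarrow> bool" where
  "total_recursive k h \<longleftrightarrow> partial_recursive k (\<lambda>xs. Some (h xs))"


section \<open>Strings and algorithmic information content\<close>

text \<open>The digits 0 and 1 are \<open>False\<close> and \<open>True\<close>.\<close>

type_synonym str = "bool list"

text \<open>
  The rank of a string in the length-lexicographic order: \<open>s\<close> has rank \<open>n\<close> iff \<open>1s\<close> is the
  binary expansion of \<open>n + 1\<close>.
\<close>

definition str_code :: "str \<Rightarrow> nat" where
  "str_code s = foldl (\<lambda>n b. 2 * n + (if b then 2 else 1)) 0 s"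

lemma str_code_Nil [simp]: "str_code [] = 0"
  by (simp add: str_code_def)

lemma str_code_snoc [simp]: "str_code (s @ [b]) = 2 * str_code s + (if b then 2 else 1)"
  by (simp add: str_code_def)

lemma bij_str_code: "bij str_code"
proof (rule bijI)
  show "inj str_code"
  proof (rule injI)
    fix s t show "str_code s = str_code t \<Longrightarrow> s = t"
    proof (induction s arbitrary: t rule: rev_induct)
      case Nil
      then show ?case by (cases t rule: rev_cases) (auto split: if_splits)
    next
      case (snoc b s)
      then obtain t' b' where t: "t = t' @ [b']"
        by (cases t rule: rev_cases) (auto split: if_splits)
      with snoc.prems have eq:
        "2 * str_code s + (if b then 2 else 1) = 2 * str_code t' + (if b' then 2 else 1)"
        by simp
      then have "b = b'" by (cases b; cases b'; simp; presburger)
      with eq t snoc.IH show ?case by auto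
    qed
  qed
  have "\<exists>s. str_code s = n" for n
  proof (induction n rule: less_induct)
    case (less n)
    show ?case
    proof (cases "n = 0")
      case True
      then show ?thesis by (metis str_code_Nil)
    next
      case False
      then obtain s where "str_code s = (n - 1) div 2"
        using less.IH[of "(n - 1) div 2"] by (metis False div_less_dividend div_le_dividend
            diff_less gr0I le_less_trans less_one)
      then have "str_code (s @ [even n]) = n"
        using False by (auto elim!: evenE oddE)
      then show ?thesis by blast
    qed
  qed
  then show "surj str_code" by (metis surjI)
qed

abbreviation str_decode :: "nat \<Rightarrow> str" where
  "str_decode \<equiv> inv str_code"

definition str_hat :: "str \<Rightarrow> str" where
  "str_hat s = concat (map (\<lambda>b. [b, b]) s) @ [False, True]"

text \<open>A machine is identified with the partial function on strings that it computes.\<close>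

definition machine :: "(str \<Rightarrow> str option) \<Rightarrow> bool" where
  "machine F \<longleftrightarrow>
    partial_recursive 1 (\<lambda>xs. map_option str_code (F (str_decode (xs ! 0))))"

text \<open>
  \<open>A 1, A 2, \<dots>\<close> lists exactly the machines, and \<open>(m, p) \<mapsto> A m p\<close> is partial recursive on
  \<open>m \<ge> 1\<close>. The value \<open>A 0\<close> is not part of the enumeration.
\<close>

definition recursive_enumeration :: "(nat \<Rightarrow> str \<Rightarrow> str option) \<Rightarrow> bool" where
  "recursive_enumeration A \<longleftrightarrow>
    A ` {1..} = Collect machine \<and>
    partial_recursive 2 (\<lambda>xs. map_option str_code (A (Suc (xs ! 0)) (str_decode (xs ! 1))))"

definition universal_machine ::
  "(nat \<Rightarrow> str \<Rightarrow> str option) \<Rightarrow> (str \<Rightarrow> str option) \<Rightarrow> bool" where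
  "universal_machine A U \<longleftrightarrow>
    machine U \<and> (\<forall>m\<ge>1. \<forall>p. U (str_hat (str_decode m) @ p) = A m p)"

definition AIC :: "(str \<Rightarrow> str option) \<Rightarrow> str \<Rightarrow> nat" where
  "AIC U s = (LEAST n. \<exists>p. U p = Some s \<and> length p = n)"

text \<open>
  A choice, for every \<open>N \<ge> 1\<close>, of a computable bijection from the words over \<open>{0, \<dots>, N - 1}\<close>
  onto the binary strings.
\<close>

definition word_encoding :: "(nat \<Rightarrow> nat list \<Rightarrow> str) \<Rightarrow> bool" where
  "word_encoding E \<longleftrightarrow>
    (\<forall>N\<ge>1. bij_betw (E N) (lists {..<N}) UNIV \<and>
      (\<exists>h. total_recursive 1 h \<and>
        (\<forall>w\<in>lists {..<N}. h [list_encode w] = str_code (E N w))))"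

definition word_AIC ::
  "(str \<Rightarrow> str option) \<Rightarrow> (nat \<Rightarrow> nat list \<Rightarrow> str) \<Rightarrow> nat \<Rightarrow> nat list \<Rightarrow> nat" where
  "word_AIC U E N w = AIC U (E N w)"


section \<open>Computable structures and constructive systems\<close>

text \<open>A rational is coded by its numerator and denominator in lowest terms.\<close>

definition rat_code :: "rat \<Rightarrow> nat" where
  "rat_code q = (case quotient_of q of (a, b) \<Rightarrow> prod_encode (int_encode a, nat b))"

definition total_recursive_rat :: "(str \<Rightarrow> str \<Rightarrow> nat \<Rightarrow> rat) \<Rightarrow> bool" where
  "total_recursive_rat D \<longleftrightarrow>
    total_recursive 3
      (\<lambda>xs. rat_code (D (str_decode (xs ! 0)) (str_decode (xs ! 1)) (xs ! 2)))"

definition computable_dist :: "(str \<Rightarrow> 'a::metric_space) \<Rightarrow> (str \<Rightarrow> 'a) \<Rightarrow> bool" where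
  "computable_dist I J \<longleftrightarrow>
    (\<exists>D. total_recursive_rat D \<and>
      (\<forall>s t n. \<bar>dist (I s) (J t) - real_of_rat (D s t n)\<bar> \<le> (1 / 2) ^ n))"

definition computable_interpretation :: "(str \<Rightarrow> 'a::metric_space) \<Rightarrow> bool" where
  "computable_interpretation I \<longleftrightarrow> closure (range I) = UNIV \<and> computable_dist I I"

definition interpretation_equiv :: "((str \<Rightarrow> 'a::metric_space) \<times> (str \<Rightarrow> 'a)) set" where
  "interpretation_equiv =
    {(I, J). computable_interpretation I \<and> computable_interpretation J \<and> computable_dist I J}"

definition computable_structure :: "(str \<Rightarrow> 'a::metric_space) set \<Rightarrow> bool" where
  "computable_structure \<I> \<longleftrightarrow> \<I> \<in> Collect computable_interpretation // interpretation_equiv"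

definition computable_morphism ::
  "(str \<Rightarrow> 'a::metric_space) set \<Rightarrow> ('a \<Rightarrow> 'a) \<Rightarrow> bool" where
  "computable_morphism \<I> T \<longleftrightarrow>
    uniformly_continuous_on UNIV T \<and> (\<forall>I\<in>\<I>. \<forall>J\<in>\<I>. computable_dist (T \<circ> I) J)"

definition effectively_uniformly_continuous :: "('a::metric_space \<Rightarrow> 'a) \<Rightarrow> bool" where
  "effectively_uniformly_continuous T \<longleftrightarrow>
    (\<exists>g :: nat \<Rightarrow> nat. total_recursive 1 (\<lambda>xs. g (xs ! 0)) \<and>
      (\<forall>x y n. dist x y < (1 / 2) ^ g n \<longrightarrow> dist (T x) (T y) < (1 / 2) ^ n))"

definition constructive :: "(str \<Rightarrow> 'a::metric_space) set \<Rightarrow> ('a \<Rightarrow> 'a) \<Rightarrow> bool" where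
  "constructive \<I> T \<longleftrightarrow> computable_morphism \<I> T \<and> effectively_uniformly_continuous T"

definition orbit :: "('a \<Rightarrow> 'a) \<Rightarrow> 'a \<Rightarrow> 'a set" where
  "orbit T x = range (\<lambda>k. (T ^^ k) x)"


section \<open>Orbit complexity\<close>

text \<open>A finite cover \<open>{B\<^sub>0, \<dots>, B\<^sub>N\<^sub>-\<^sub>1}\<close> is the list of its members.\<close>

definition finite_open_cover :: "'a::topological_space set list \<Rightarrow> bool" where
  "finite_open_cover \<beta> \<longleftrightarrow> (\<forall>B\<in>set \<beta>. open B) \<and> \<Union>(set \<beta>) = UNIV"

definition itineraries :: "('a \<Rightarrow> 'a) \<Rightarrow> 'a set list \<Rightarrow> 'a \<Rightarrow> (nat \<Rightarrow> nat) set" where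
  "itineraries T \<beta> x = {\<omega>. \<forall>n. \<omega> n < length \<beta> \<and> (T ^^ n) x \<in> \<beta> ! \<omega> n}"

definition prefix_word :: "(nat \<Rightarrow> nat) \<Rightarrow> nat \<Rightarrow> nat list" where
  "prefix_word \<omega> n = map \<omega> [0..<n]"

text \<open>
  For fixed \<open>n\<close> only finitely many words of length \<open>n\<close> occur, so the infimum is a minimum.
\<close>

definition cover_complexity ::
  "(str \<Rightarrow> str option) \<Rightarrow> (nat \<Rightarrow> nat list \<Rightarrow> str) \<Rightarrow> (nat \<Rightarrow> real) \<Rightarrow> ('a \<Rightarrow> 'a)
    \<Rightarrow> 'a set list \<Rightarrow> 'a \<Rightarrow> ereal" where
  "cover_complexity U E f T \<beta> x =
    limsup (\<lambda>n. INF \<omega>\<in>itineraries T \<beta> x.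
      ereal (real (word_AIC U E (length \<beta>) (prefix_word \<omega> n)) / f n))"

definition orbit_complexity ::
  "(str \<Rightarrow> str option) \<Rightarrow> (nat \<Rightarrow> nat list \<Rightarrow> str) \<Rightarrow> (nat \<Rightarrow> real)
    \<Rightarrow> ('a::metric_space \<Rightarrow> 'a) \<Rightarrow> 'a \<Rightarrow> ereal" where
  "orbit_complexity U E f T x =
    (SUP \<beta>\<in>Collect finite_open_cover. cover_complexity U E f T \<beta> x)"


section \<open>Initial-condition sensitivity\<close>

definition log2_ereal :: "ereal \<Rightarrow> ereal" where
  "log2_ereal r =
    (if r \<le> 0 then -\<infinity> else if r = \<infinity> then \<infinity> else ereal (log 2 (real_of_ereal r)))"

definition dyn_ball :: "('a::metric_space \<Rightarrow> 'a) \<Rightarrow> nat \<Rightarrow> 'a \<Rightarrow> real \<Rightarrow> 'a set" where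
  "dyn_ball T n x \<epsilon> = {y. \<forall>i\<le>n. dist ((T ^^ i) y) ((T ^^ i) x) \<le> \<epsilon>}"

text \<open>The radius is \<open>\<infinity>\<close> if the dynamical ball is the whole space.\<close>

definition sens_radius :: "('a::metric_space \<Rightarrow> 'a) \<Rightarrow> 'a \<Rightarrow> nat \<Rightarrow> real \<Rightarrow> ereal" where
  "sens_radius T x n \<epsilon> = (SUP r\<in>{r. ball x r \<subseteq> dyn_ball T n x \<epsilon>}. ereal r)"

definition sensitivity_at ::
  "(nat \<Rightarrow> real) \<Rightarrow> ('a::metric_space \<Rightarrow> 'a) \<Rightarrow> real \<Rightarrow> 'a \<Rightarrow> ereal" where
  "sensitivity_at f T \<epsilon> x = limsup (\<lambda>n. - log2_ereal (sens_radius T x n \<epsilon>) / ereal (f n))"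

definition sensitivity ::
  "(nat \<Rightarrow> real) \<Rightarrow> ('a::metric_space \<Rightarrow> 'a) \<Rightarrow> 'a \<Rightarrow> ereal" where
  "sensitivity f T x = (SUP \<epsilon>\<in>{0<..}. sensitivity_at f T \<epsilon> x)"


section \<open>Box dimension\<close>

text \<open>Balls are open and their centres may be any points of the space, not only of \<open>F\<close>.\<close>

definition covering_number :: "real \<Rightarrow> 'a::metric_space set \<Rightarrow> nat" where
  "covering_number \<delta> F =
    (LEAST n. \<exists>C. finite C \<and> card C = n \<and> F \<subseteq> (\<Union>c\<in>C. ball c \<delta>))"

definition upper_box_dim :: "'a::metric_space set \<Rightarrow> ereal" where
  "upper_box_dim F =
    Limsup (at_right 0) (\<lambda>\<delta>. ereal (log 2 (real (covering_number \<delta> F)) / - log 2 \<delta>))"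

text \<open>
  In \<^typ>\<open>ereal\<close> the product of 0 and an infinity is 0, so the indeterminate form has to be
  excluded explicitly.
\<close>

definition determinate_product :: "ereal \<Rightarrow> ereal \<Rightarrow> bool" where
  "determinate_product a b \<longleftrightarrow> \<not> (a = 0 \<and> \<bar>b\<bar> = \<infinity>) \<and> \<not> (\<bar>a\<bar> = \<infinity> \<and> b = 0)"

end

theory Submission
  imports Defs "HOL-Real_Asymp.Real_Asymp"
begin

text \<open>
  To describe the first \<open>n\<close> letters of an itinerary of \<open>x\<close> it suffices to name a point that shadows
  the orbit of \<open>x\<close> up to time \<open>n\<close>. If the ball of radius \<open>2^-j\<close> about \<open>x\<close> lies in the dynamical ball
  of order \<open>n\<close>, every point of a net of mesh \<open>2^-j\<close> near \<open>x\<close> is such a shadow. A program may therefore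
  consist of \<open>n\<close>, of \<open>j\<close>, and of the position \<open>k\<close> of the shadow in a net which the machine builds by
  itself. By definition of the sensitivity, \<open>j\<close> may be taken close to \<open>r * f n\<close>, and \<open>k\<close> is bounded by
  a covering number at a scale comparable to \<open>2^-j\<close>, hence by about \<open>2^(d * j)\<close>, where \<open>d\<close> is the box
  dimension. This gives \<open>d * r * f n + log n\<close> bits, up to lower order terms; the summand \<open>log n\<close>
  accounts for the extra \<open>1\<close> when \<open>f = log\<close>, and disappears when \<open>log n = o(f n)\<close>.

  Three points need care. First, the leading coefficients have to be \<open>1\<close>, so \<open>n\<close>, \<open>j\<close> and \<open>k\<close> must
  be packed into a string of length \<open>log n + log k + O(log j + log log n)\<close> (\<open>triple_coding\<close>). Secondly,
  finite covers of the space by small balls need not be computable from the data. The net is extracted greedily from a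
  sequence of points: \<open>t\<close> is kept if no earlier kept point is found to be close to it
  (\<open>decidable_greedy_net\<close>). Distances are only known up to an error, but a test that never confuses
  \<open>dist < 2^-(j + 2)\<close> with \<open>dist \<ge> 2^-j\<close> is decidable (\<open>computable_dist_gap_decider\<close>), and
  such a test suffices, since kept points are then separated (which bounds their number by a
  covering number) and yet dense at scale \<open>2^-j\<close>. The search for the \<open>k\<close>-th kept point is the
  only partial step of the machine. Thirdly, the sets of the cover are arbitrary open sets. A finite
  table, obtained from a Lebesgue number of the cover, assigns to each of finitely many ideal points a
  letter that is correct in a whole ball about it; the machine looks up its approximation of the orbit of
  the shadow in this table. That orbit is itself computable with any precision because \<open>T\<close> has a
  computable modulus of continuity (\<open>constructive_approximates_orbits\<close>).

  The net is drawn from a sequence \<open>y t = T^(a t) (I (b t))\<close> with recursive \<open>a\<close> and \<open>b\<close>. Taking all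
  ideal points gives the inequalities for the whole space, and taking the orbit of one ideal point
  those for orbit closures. Likewise the rates \<open>log n = o(f n)\<close> and \<open>f n = log n\<close> are the cases
  \<open>l = 0\<close> and \<open>l = 1\<close> of the assumption that \<open>log n / f n\<close> tends to \<open>l\<close> (\<open>orbit_complexity_le\<close>).
\<close>

section \<open>Closure properties of recursive functions and decidable relations\<close>

lemma computes_deterministic:
  assumes "computes r xs y" and "computes r xs z"
  shows "y = z"
  using assms
proof (induction arbitrary: z rule: computes.induct)
  case (zero xs)
  then show ?case by (auto elim: computes.cases)
next
  case (succ x)
  then show ?case by (auto elim: computes.cases)
next
  case (proj i xs)
  then show ?case by (auto elim: computes.cases)
next
  case (comp xs gs ys f z z')
  from comp.prems obtain ys' where ys': "list_all2 (\<lambda>g y. computes g xs y) gs ys'" "computes f ys' z'"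
    by (auto elim: computes.cases)
  have "ys = ys'"
    using comp.hyps(1) comp.IH(1) ys'(1)
    by (auto simp: list_all2_conv_all_nth intro!: nth_equalityI)
  then show ?case using comp.IH ys' by auto
next
  case (prim_zero f xs z g z')
  from prim_zero.prems show ?case by (cases rule: computes.cases) (auto dest: prim_zero.IH)
next
  case (prim_suc f g n xs y z z')
  from prim_suc.prems obtain y' where "computes (PrimRec f g) (n # xs) y'" "computes g (n # y' # xs) z'"
    by (cases rule: computes.cases) auto
  with prim_suc.IH show ?case by metis
next
  case (mu f n xs m)
  from mu.prems have m: "computes f (m # xs) 0" "\<forall>i<m. \<exists>y. computes f (i # xs) (Suc y)"
    by (auto elim: computes.cases)
  show ?case
  proof (rule linorder_cases[of n m])
    assume "n < m"
    then show ?thesis using m mu.IH by (metis nat.distinct(1))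
  next
    assume "m < n"
    then show ?thesis using m mu.IH by (metis nat.distinct(1))
  qed
qed

lemma total_recursive_iff:
  "total_recursive k h \<longleftrightarrow> (\<exists>r. \<forall>xs. length xs = k \<longrightarrow> computes r xs (h xs))"
  unfolding total_recursive_def partial_recursive_def using computes_deterministic by fastforce

lemma total_recursive_cong:
  assumes "total_recursive k F" and "\<And>xs. length xs = k \<Longrightarrow> F xs = G xs"
  shows "total_recursive k G"
  using assms unfolding total_recursive_iff by fastforce

lemma recursive_nth: "i < k \<Longrightarrow> total_recursive k (\<lambda>xs. xs ! i)"
  unfolding total_recursive_iff by (rule exI[of _ "Proj i"]) (auto intro: computes.intros)

lemma recursive_nth_drop: "m + i < k \<Longrightarrow> total_recursive k (\<lambda>xs. drop m xs ! i)"
  by (rule total_recursive_cong[OF recursive_nth[of "m + i"]]) auto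

text \<open>
  Access to the parameters from below two nested binders.
\<close>

lemma recursive_nth_drop_drop: "n + m + i < k \<Longrightarrow> total_recursive k (\<lambda>xs. drop m (drop n xs) ! i)"
  by (rule total_recursive_cong[OF recursive_nth[of "n + m + i"]]) (auto simp: ac_simps)

text \<open>
  Composition with an arbitrary list of inner functions. The forms for one, two and three arguments below
  let closure properties be applied to curried functions as introduction rules.
\<close>

lemma recursive_apply:
  assumes "total_recursive m h" and "length gs = m" and "\<forall>g\<in>set gs. total_recursive k g"
  shows "total_recursive k (\<lambda>xs. h (map (\<lambda>g. g xs) gs))"
proof -
  obtain r where r: "\<And>xs. length xs = m \<Longrightarrow> computes r xs (h xs)"
    using assms(1) unfolding total_recursive_iff by auto
  obtain p where p: "\<And>g xs. g \<in> set gs \<Longrightarrow> length xs = k \<Longrightarrow> computes (p g) xs (g xs)"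
    using assms(3) unfolding total_recursive_iff by metis
  have "computes (Comp r (map p gs)) xs (h (map (\<lambda>g. g xs) gs))" if "length xs = k" for xs
    using that assms(2)
    by (intro computes.comp[where ys = "map (\<lambda>g. g xs) gs"] r)
      (auto simp: list_all2_conv_all_nth intro: p)
  then show ?thesis unfolding total_recursive_iff by blast
qed

lemma recursive_apply1:
  assumes "total_recursive 1 (\<lambda>xs. h (xs ! 0))" and "total_recursive k F"
  shows "total_recursive k (\<lambda>xs. h (F xs))"
  using recursive_apply[OF assms(1), of "[F]" k] assms(2) by simp

lemma recursive_apply2:
  assumes "total_recursive 2 (\<lambda>xs. h (xs ! 0) (xs ! 1))"
    and "total_recursive k F" and "total_recursive k G"
  shows "total_recursive k (\<lambda>xs. h (F xs) (G xs))"
  using recursive_apply[OF assms(1), of "[F, G]" k] assms(2,3) by simp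

lemma recursive_apply3:
  assumes "total_recursive 3 (\<lambda>xs. h (xs ! 0) (xs ! 1) (xs ! 2))"
    and "total_recursive k F" and "total_recursive k G" and "total_recursive k H"
  shows "total_recursive k (\<lambda>xs. h (F xs) (G xs) (H xs))"
  using recursive_apply[OF assms(1), of "[F, G, H]" k] assms(2-4) by simp

lemma recursive_Suc:
  assumes "total_recursive k F"
  shows "total_recursive k (\<lambda>xs. Suc (F xs))"
proof -
  have "total_recursive 1 (\<lambda>xs. Suc (xs ! 0))"
    unfolding total_recursive_iff
    by (rule exI[of _ Succ]) (auto simp: length_Suc_conv intro: computes.intros)
  from recursive_apply1[OF this assms] show ?thesis .
qed

lemma recursive_const: "total_recursive k (\<lambda>xs. c)"
proof (induction c)
  case 0
  show ?case unfolding total_recursive_iff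
    by (rule exI[of _ Zero]) (auto intro: computes.intros)
next
  case (Suc c)
  then show ?case by (rule recursive_Suc)
qed

text \<open>
  The step function may use all parameters: in the extended argument list they follow the counter and
  the previous value, which is why they reappear as \<open>drop 2 ys\<close>. The rules below for bounded
  quantifiers and for minimisation bind variables in the same way.
\<close>

lemma recursive_rec_nat:
  assumes c: "total_recursive k c" and b: "total_recursive k b"
    and s: "total_recursive (Suc (Suc k)) (\<lambda>ys. s (ys ! 0) (ys ! 1) (drop 2 ys))"
  shows "total_recursive k (\<lambda>xs. rec_nat (b xs) (\<lambda>n y. s n y xs) (c xs))"
proof -
  obtain rb where rb: "\<And>xs. length xs = k \<Longrightarrow> computes rb xs (b xs)"
    using b unfolding total_recursive_iff by auto
  obtain rs where rs: "\<And>n y xs. length xs = k \<Longrightarrow> computes rs (n # y # xs) (s n y xs)"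
  proof -
    from s obtain r where
      "\<forall>ys. length ys = Suc (Suc k) \<longrightarrow> computes r ys (s (ys ! 0) (ys ! 1) (drop 2 ys))"
      unfolding total_recursive_iff by auto
    then have "computes r (n # y # xs) (s n y xs)" if "length xs = k" for n y xs
      using that by (auto dest: spec[of _ "n # y # xs"])
    with that show ?thesis by blast
  qed
  obtain rc where rc: "\<And>xs. length xs = k \<Longrightarrow> computes rc xs (c xs)"
    using c unfolding total_recursive_iff by auto
  have rec: "computes (PrimRec rb rs) (n # xs) (rec_nat (b xs) (\<lambda>n y. s n y xs) n)"
    if "length xs = k" for n xs
    by (induction n) (auto intro: computes.intros rb rs that)
  have "computes (Comp (PrimRec rb rs) (rc # map Proj [0..<k])) xs
      (rec_nat (b xs) (\<lambda>n y. s n y xs) (c xs))" if "length xs = k" for xs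
  proof (rule computes.comp)
    show "list_all2 (\<lambda>g y. computes g xs y) (rc # map Proj [0..<k]) (c xs # xs)"
      using that rc by (auto simp: list_all2_conv_all_nth nth_Cons' intro!: computes.proj)
  qed (rule rec[OF that])
  then show ?thesis unfolding total_recursive_iff by blast
qed

lemmas recursive_basic =
  recursive_nth recursive_nth_drop recursive_nth_drop_drop recursive_Suc recursive_const

lemma recursive_add:
  assumes "total_recursive k F" and "total_recursive k G"
  shows "total_recursive k (\<lambda>xs. F xs + G xs)"
proof -
  have eq: "rec_nat m (\<lambda>_ y. Suc y) n = m + n" for m n :: nat by (induction n) auto
  have "total_recursive 2 (\<lambda>xs. rec_nat (xs ! 0) (\<lambda>_ y. Suc y) (xs ! 1))"
    by (intro recursive_rec_nat recursive_basic) auto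
  from recursive_apply2[OF this[unfolded eq] assms] show ?thesis .
qed

lemma recursive_mult:
  assumes "total_recursive k F" and "total_recursive k G"
  shows "total_recursive k (\<lambda>xs. F xs * G xs)"
proof -
  have eq: "rec_nat 0 (\<lambda>_ y. y + m) n = m * n" for m n :: nat by (induction n) auto
  have "total_recursive 2 (\<lambda>xs. rec_nat 0 (\<lambda>_ y. y + xs ! 0) (xs ! 1))"
    by (intro recursive_rec_nat recursive_add recursive_basic) auto
  from recursive_apply2[OF this[unfolded eq] assms] show ?thesis .
qed

lemma recursive_power:
  assumes "total_recursive k F" and "total_recursive k G"
  shows "total_recursive k (\<lambda>xs. F xs ^ G xs)"
proof -
  have eq: "rec_nat 1 (\<lambda>_ y. y * m) n = m ^ n" for m n :: nat by (induction n) auto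
  have "total_recursive 2 (\<lambda>xs. rec_nat 1 (\<lambda>_ y. y * xs ! 0) (xs ! 1))"
    by (intro recursive_rec_nat recursive_mult recursive_basic) auto
  from recursive_apply2[OF this[unfolded eq] assms] show ?thesis .
qed

lemma recursive_diff:
  assumes "total_recursive k F" and "total_recursive k G"
  shows "total_recursive k (\<lambda>xs. F xs - G xs)"
proof -
  have pred: "rec_nat 0 (\<lambda>i y. i) n = n - 1" for n :: nat by (cases n) auto
  have "total_recursive 1 (\<lambda>xs. rec_nat 0 (\<lambda>i y. i) (xs ! 0))"
    by (intro recursive_rec_nat recursive_basic) auto
  note recursive_pred = recursive_apply1[OF this[unfolded pred]]
  have eq: "rec_nat m (\<lambda>_ y. y - 1) n = m - n" for m n :: nat by (induction n) auto
  have "total_recursive 2 (\<lambda>xs. rec_nat (xs ! 0) (\<lambda>_ y. y - 1) (xs ! 1))"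
    by (intro recursive_rec_nat recursive_pred recursive_basic) auto
  from recursive_apply2[OF this[unfolded eq] assms] show ?thesis .
qed

definition decidable_rel :: "nat \<Rightarrow> (nat list \<Rightarrow> bool) \<Rightarrow> bool" where
  "decidable_rel k P \<longleftrightarrow> total_recursive k (\<lambda>xs. of_bool (P xs))"

lemma decidable_less:
  assumes "total_recursive k F" and "total_recursive k G"
  shows "decidable_rel k (\<lambda>xs. F xs < G xs)"
proof -
  have "total_recursive k (\<lambda>xs. 1 - (Suc (F xs) - G xs))"
    by (intro recursive_diff recursive_Suc recursive_const assms)
  then show ?thesis
    unfolding decidable_rel_def by (rule total_recursive_cong) auto
qed

lemma decidable_not:
  assumes "decidable_rel k P"
  shows "decidable_rel k (\<lambda>xs. \<not> P xs)"
proof -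
  have "total_recursive k (\<lambda>xs. 1 - of_bool (P xs))"
    using assms by (intro recursive_diff recursive_const) (auto simp: decidable_rel_def)
  then show ?thesis
    unfolding decidable_rel_def by (rule total_recursive_cong) auto
qed

lemma decidable_conj:
  assumes "decidable_rel k P" and "decidable_rel k Q"
  shows "decidable_rel k (\<lambda>xs. P xs \<and> Q xs)"
proof -
  have "total_recursive k (\<lambda>xs. of_bool (P xs) * of_bool (Q xs))"
    using assms by (intro recursive_mult) (auto simp: decidable_rel_def)
  then show ?thesis
    unfolding decidable_rel_def by (rule total_recursive_cong) auto
qed

lemma decidable_disj:
  assumes "decidable_rel k P" and "decidable_rel k Q"
  shows "decidable_rel k (\<lambda>xs. P xs \<or> Q xs)"
  using decidable_not[OF decidable_conj[OF decidable_not decidable_not, OF assms]] by simp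

lemma decidable_eq:
  assumes "total_recursive k F" and "total_recursive k G"
  shows "decidable_rel k (\<lambda>xs. F xs = G xs)"
proof -
  have "decidable_rel k (\<lambda>xs. \<not> (F xs < G xs) \<and> \<not> (G xs < F xs))"
    by (intro decidable_conj decidable_not decidable_less assms)
  then show ?thesis
    by (simp add: not_less antisym_conv1 eq_iff conj_commute)
qed

lemma recursive_if:
  assumes "decidable_rel k P" and "total_recursive k F" and "total_recursive k G"
  shows "total_recursive k (\<lambda>xs. if P xs then F xs else G xs)"
proof -
  have "total_recursive k (\<lambda>xs. of_bool (P xs) * F xs + (1 - of_bool (P xs)) * G xs)"
    using assms by (intro recursive_add recursive_mult recursive_diff recursive_const) (auto simp: decidable_rel_def)
  then show ?thesis by (rule total_recursive_cong) auto
qed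

lemma decidable_apply3:
  assumes "decidable_rel 3 (\<lambda>xs. P (xs ! 0) (xs ! 1) (xs ! 2))"
    and "total_recursive k F" and "total_recursive k G" and "total_recursive k H"
  shows "decidable_rel k (\<lambda>xs. P (F xs) (G xs) (H xs))"
  using recursive_apply3[OF assms(1)[unfolded decidable_rel_def] assms(2-4)]
  unfolding decidable_rel_def .

lemma recursive_count_below:
  assumes c: "total_recursive k c"
    and P: "decidable_rel (Suc (Suc k)) (\<lambda>ys. P (ys ! 0) (drop 2 ys))"
  shows "total_recursive k (\<lambda>xs. card {b. b < c xs \<and> P b xs})"
proof -
  have eq: "rec_nat 0 (\<lambda>b y. y + of_bool (P b xs)) n = card {b. b < n \<and> P b xs}" for n xs
  proof (induction n)
    case (Suc n)
    have "{b. b < Suc n \<and> P b xs} =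
        (if P n xs then insert n {b. b < n \<and> P b xs} else {b. b < n \<and> P b xs})"
      by (auto simp: less_Suc_eq)
    with Suc show ?case by auto
  qed auto
  have "total_recursive k (\<lambda>xs. rec_nat 0 (\<lambda>b y. y + of_bool (P b xs)) (c xs))"
    using P by (intro recursive_rec_nat recursive_add recursive_basic c) (auto simp: decidable_rel_def)
  then show ?thesis unfolding eq .
qed

lemma decidable_bex:
  assumes c: "total_recursive k c"
    and P: "decidable_rel (Suc (Suc k)) (\<lambda>ys. P (ys ! 0) (drop 2 ys))"
  shows "decidable_rel k (\<lambda>xs. \<exists>b<c xs. P b xs)"
proof -
  have "decidable_rel k (\<lambda>xs. 0 < card {b. b < c xs \<and> P b xs})"
    by (intro decidable_less recursive_count_below recursive_const assms)
  then show ?thesis by (simp add: card_gt_0_iff)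
qed

text \<open>
  The one source of partiality that is needed: an unbounded search over a decidable relation, followed by
  a total function of the witness. A program that names a
  position beyond the end of a finite net makes this search diverge.
\<close>

lemma partial_recursive_search:
  assumes P: "decidable_rel 2 (\<lambda>xs. P (xs ! 0) (xs ! 1))"
    and H: "total_recursive 2 (\<lambda>xs. H (xs ! 0) (xs ! 1))"
  shows "partial_recursive 1 (\<lambda>xs.
    if \<exists>t. P t (xs ! 0) then Some (H (LEAST t. P t (xs ! 0)) (xs ! 0)) else None)"
  (is "partial_recursive 1 ?F")
proof -
  obtain p where p0:
    "\<And>xs. length xs = 2 \<Longrightarrow> computes p xs (of_bool (\<not> P (xs ! 0) (xs ! 1)))"
    using decidable_not[OF P] unfolding decidable_rel_def total_recursive_iff by auto
  have p: "computes p [t, z] (of_bool (\<not> P t z))" for t z using p0[of "[t, z]"] by simp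
  obtain h where h0: "\<And>xs. length xs = 2 \<Longrightarrow> computes h xs (H (xs ! 0) (xs ! 1))"
    using H unfolding total_recursive_iff by auto
  have h: "computes h [t, z] (H t z)" for t z using h0[of "[t, z]"] by simp
  let ?r = "Comp h [Mu p, Proj 0]"
  have halts: "computes ?r [z] (H (LEAST t. P t z) z)" if ex: "\<exists>t. P t z" for z
  proof -
    let ?n = "LEAST t. P t z"
    have "P ?n z" using ex by (rule LeastI_ex)
    have "computes (Mu p) [z] ?n"
    proof (rule computes.mu)
      show "computes p [?n, z] 0" using p[of ?n z] \<open>P ?n z\<close> by simp
      show "\<forall>i<?n. \<exists>y. computes p [i, z] (Suc y)"
      proof (intro allI impI)
        fix i assume "i < ?n"
        then have "\<not> P i z" by (rule not_less_Least)
        then show "\<exists>y. computes p [i, z] (Suc y)" using p[of i z] by auto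
      qed
    qed
    then show ?thesis
      by (intro computes.comp[where ys = "[?n, z]"])
        (auto intro: h computes.proj[of 0 "[z]", simplified])
  qed
  have "computes ?r xs y \<longleftrightarrow> ?F xs = Some y" if "length xs = 1" for xs y
  proof -
    obtain z where xs: "xs = [z]" using \<open>length xs = 1\<close> by (auto simp: length_Suc_conv)
    show ?thesis
    proof
      assume r: "computes ?r xs y"
      then obtain n where "computes (Mu p) [z] n"
        unfolding xs by (cases rule: computes.cases) (auto simp: list_all2_Cons1)
      then have "computes p [n, z] 0" by (cases rule: computes.cases) auto
      with p[of n z] have "P n z" using computes_deterministic by fastforce
      then have ex: "\<exists>t. P t z" ..
      with r have "y = H (LEAST t. P t z) z"
        unfolding xs by (intro computes_deterministic[OF _ halts])
      with ex xs show "?F xs = Some y" by simp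
    next
      assume F: "?F xs = Some y"
      then have "\<exists>t. P t z" using xs by (auto split: if_splits)
      with halts[OF this] F xs show "computes ?r xs y" by auto
    qed
  qed
  then show ?thesis unfolding partial_recursive_def by blast
qed

lemma recursive_Least:
  assumes P: "decidable_rel (Suc k) (\<lambda>ys. P (ys ! 0) (drop 1 ys))"
    and ex: "\<And>xs. length xs = k \<Longrightarrow> \<exists>n. P n xs"
  shows "total_recursive k (\<lambda>xs. LEAST n. P n xs)"
proof -
  from decidable_not[OF P] obtain r where
    r0: "\<forall>ys. length ys = Suc k \<longrightarrow> computes r ys (of_bool (\<not> P (ys ! 0) (drop 1 ys)))"
    unfolding decidable_rel_def total_recursive_iff by auto
  have r: "computes r (n # xs) (of_bool (\<not> P n xs))" if "length xs = k" for n xs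
    using that r0[rule_format, of "n # xs"] by simp
  have "computes (Mu r) xs (LEAST n. P n xs)" if "length xs = k" for xs
  proof (rule computes.mu)
    have "P (LEAST n. P n xs) xs" using ex[OF that] by (rule LeastI_ex)
    then show "computes r ((LEAST n. P n xs) # xs) 0" using r[OF that, of "LEAST n. P n xs"] by simp
    show "\<forall>i<LEAST n. P n xs. \<exists>y. computes r (i # xs) (Suc y)"
    proof (intro allI impI)
      fix i assume "i < (LEAST n. P n xs)"
      then have "\<not> P i xs" by (rule not_less_Least)
      then show "\<exists>y. computes r (i # xs) (Suc y)" using r[OF that, of i] by auto
    qed
  qed
  then show ?thesis unfolding total_recursive_iff by blast
qed

lemma recursive_div:
  assumes "total_recursive k F" and "total_recursive k G"
  shows "total_recursive k (\<lambda>xs. F xs div G xs)"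
proof -
  \<comment> \<open>The disjunct \<open>n = 0\<close> makes the search terminate and returns the value \<open>m div 0 = 0\<close>.\<close>
  have eq: "(LEAST q. n = 0 \<or> m < Suc q * n) = m div n" for m n :: nat
  proof (cases "n = 0")
    case False
    then have iff: "(n = 0 \<or> m < Suc q * n) \<longleftrightarrow> m div n \<le> q" for q
      by (metis div_less_iff_less_mult gr0I less_Suc_eq_le)
    show ?thesis unfolding iff by (rule Least_equality) auto
  qed (auto intro: Least_equality)
  have "total_recursive 2 (\<lambda>xs. LEAST q. xs ! 1 = 0 \<or> xs ! 0 < Suc q * xs ! 1)"
  proof (rule recursive_Least)
    show "decidable_rel (Suc 2) (\<lambda>ys. drop 1 ys ! 1 = 0 \<or> drop 1 ys ! 0 < Suc (ys ! 0) * drop 1 ys ! 1)"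
      by (intro decidable_disj decidable_eq decidable_less recursive_mult recursive_basic) auto
    fix xs :: "nat list"
    have "xs ! 1 = 0 \<or> xs ! 0 < Suc (xs ! 0) * xs ! 1" by (cases "xs ! 1") auto
    then show "\<exists>q. xs ! 1 = 0 \<or> xs ! 0 < Suc q * xs ! 1" ..
  qed
  from recursive_apply2[OF this[unfolded eq] assms] show ?thesis .
qed

lemma recursive_mod:
  assumes "total_recursive k F" and "total_recursive k G"
  shows "total_recursive k (\<lambda>xs. F xs mod G xs)"
proof -
  have "total_recursive k (\<lambda>xs. F xs - F xs div G xs * G xs)"
    by (intro recursive_diff recursive_mult recursive_div assms)
  then show ?thesis by (simp add: minus_div_mult_eq_mod)
qed

lemma recursive_prod_encode:
  assumes "total_recursive k F" and "total_recursive k G"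
  shows "total_recursive k (\<lambda>xs. prod_encode (F xs, G xs))"
  unfolding prod_encode_def triangle_def split
  by (intro recursive_add recursive_mult recursive_div recursive_Suc recursive_const assms)

lemma recursive_prod_decode:
  assumes "total_recursive k F"
  shows "total_recursive k (\<lambda>xs. fst (prod_decode (F xs)))"
    and "total_recursive k (\<lambda>xs. snd (prod_decode (F xs)))"
proof -
  have le: "fst (prod_decode z) < Suc z" "snd (prod_decode z) < Suc z" for z
    using le_prod_encode_1[of "fst (prod_decode z)" "snd (prod_decode z)"]
      le_prod_encode_2[of "snd (prod_decode z)" "fst (prod_decode z)"] by auto
  have eq1: "(LEAST a. \<exists>b<Suc z. prod_encode (a, b) = z) = fst (prod_decode z)" for z
    by (rule Least_equality) (use le in \<open>force intro: exI[of _ "snd (prod_decode z)"]\<close>)+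
  have eq2: "(LEAST b. \<exists>a<Suc z. prod_encode (a, b) = z) = snd (prod_decode z)" for z
    by (rule Least_equality) (use le in \<open>force intro: exI[of _ "fst (prod_decode z)"]\<close>)+
  have "total_recursive 1 (\<lambda>xs. LEAST a. \<exists>b<Suc (xs ! 0). prod_encode (a, b) = xs ! 0)"
  proof (rule recursive_Least)
    show "decidable_rel (Suc 1)
        (\<lambda>ys. \<exists>b<Suc (drop 1 ys ! 0). prod_encode (ys ! 0, b) = drop 1 ys ! 0)"
      by (intro decidable_bex decidable_eq recursive_prod_encode recursive_basic) auto
    show "\<exists>a. \<exists>b<Suc (xs ! 0). prod_encode (a, b) = xs ! 0" for xs :: "nat list"
      using le prod_decode_inverse by (metis prod.collapse)
  qed
  from recursive_apply1[OF this[unfolded eq1] assms] show "total_recursive k (\<lambda>xs. fst (prod_decode (F xs)))" .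
  have "total_recursive 1 (\<lambda>xs. LEAST b. \<exists>a<Suc (xs ! 0). prod_encode (a, b) = xs ! 0)"
  proof (rule recursive_Least)
    show "decidable_rel (Suc 1)
        (\<lambda>ys. \<exists>a<Suc (drop 1 ys ! 0). prod_encode (a, ys ! 0) = drop 1 ys ! 0)"
      by (intro decidable_bex decidable_eq recursive_prod_encode recursive_basic) auto
    show "\<exists>b. \<exists>a<Suc (xs ! 0). prod_encode (a, b) = xs ! 0" for xs :: "nat list"
      using le prod_decode_inverse by (metis prod.collapse)
  qed
  from recursive_apply1[OF this[unfolded eq2] assms] show "total_recursive k (\<lambda>xs. snd (prod_decode (F xs)))" .
qed

lemma map_nth_shift_eq_drop:
  "length ys = m + k \<Longrightarrow> map (\<lambda>g. g ys) (map (\<lambda>i ys. ys ! (m + i)) [0..<k]) = drop m ys"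
  by (auto intro!: nth_equalityI)

lemma recursive_drop:
  assumes "total_recursive k G"
  shows "total_recursive (m + k) (\<lambda>ys. G (drop m ys))"
proof -
  have "total_recursive (m + k)
      (\<lambda>ys. G (map (\<lambda>g. g ys) (map (\<lambda>i ys. ys ! (m + i)) [0..<k])))"
    by (rule recursive_apply[OF assms]) (auto intro!: recursive_nth)
  then show ?thesis
    by (rule total_recursive_cong) (simp only: map_nth_shift_eq_drop)
qed

lemma recursive_apply_Cons_drop:
  assumes F: "total_recursive (Suc k) (\<lambda>ys. F (ys ! 0) (drop 1 ys))"
    and H: "total_recursive (m + k) H"
  shows "total_recursive (m + k) (\<lambda>ys. F (H ys) (drop m ys))"
proof -
  have "total_recursive (m + k) (\<lambda>ys. (\<lambda>zs. F (zs ! 0) (drop 1 zs))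
      (map (\<lambda>g. g ys) (H # map (\<lambda>i ys. ys ! (m + i)) [0..<k])))"
    by (rule recursive_apply[OF F]) (auto intro!: recursive_nth H)
  then show ?thesis
    by (rule total_recursive_cong) (simp only: list.map(2) map_nth_shift_eq_drop, simp)
qed

lemma recursive_list_encode_map:
  assumes c: "total_recursive k c"
    and F: "total_recursive (Suc k) (\<lambda>ys. F (ys ! 0) (drop 1 ys))"
  shows "total_recursive k (\<lambda>xs. list_encode (map (\<lambda>i. F i xs) [0..<c xs]))"
proof -
  \<comment> \<open>The code of a list nests the code of its tail, so the word is built from its last letter.\<close>
  have eq: "rec_nat 0 (\<lambda>i y. Suc (prod_encode (g (n - Suc i), y))) i
      = list_encode (map g [n - i..<n])" if "i \<le> n" for g :: "nat \<Rightarrow> nat" and n i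
    using that
  proof (induction i)
    case (Suc i)
    then have "[n - Suc i..<n] = (n - Suc i) # [n - i..<n]"
      by (subst upt_conv_Cons) (auto simp: Suc_diff_Suc Suc_le_lessD)
    with Suc show ?case by simp
  qed simp
  have c2: "total_recursive (Suc (Suc k)) (\<lambda>ys. c (drop 2 ys))"
    using recursive_drop[OF c, of 2] by simp
  have F2: "total_recursive (Suc (Suc k)) (\<lambda>ys. F (H ys) (drop 2 ys))"
    if "total_recursive (Suc (Suc k)) H" for H
    using recursive_apply_Cons_drop[OF F, of 2 H] that by simp
  have "total_recursive k
      (\<lambda>xs. rec_nat 0 (\<lambda>i y. Suc (prod_encode (F (c xs - Suc i) xs, y))) (c xs))"
    by (intro recursive_rec_nat c recursive_Suc recursive_prod_encode F2 recursive_diff c2 recursive_basic) auto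
  then show ?thesis
    by (rule total_recursive_cong) (subst eq, simp_all)
qed

text \<open>
  A finite table is computable whatever its entries \<open>b q\<close> are. This is how finitely many
  non-computable choices about an open cover enter a machine.
\<close>

lemma recursive_table_lookup:
  fixes b :: "nat \<Rightarrow> nat"
  assumes "finite Q" and "\<And>q. decidable_rel 1 (\<lambda>xs. P q (xs ! 0))"
    and "\<And>t. \<exists>q\<in>Q. P q t"
  obtains l where "total_recursive 1 (\<lambda>xs. l (xs ! 0))" and "\<And>t. \<exists>q\<in>Q. P q t \<and> l t = b q"
proof -
  have "\<exists>l. total_recursive 1 (\<lambda>xs. l (xs ! 0)) \<and>
      (\<forall>t. (\<exists>q\<in>Q. P q t) \<longrightarrow> (\<exists>q\<in>Q. P q t \<and> l t = b q))"
    using assms(1)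
  proof induction
    case empty
    show ?case by (intro exI[of _ "\<lambda>_. 0"]) (simp add: recursive_const[of _ 0, simplified])
  next
    case (insert q Q)
    then obtain l where l: "total_recursive 1 (\<lambda>xs. l (xs ! 0))"
      "\<forall>t. (\<exists>q\<in>Q. P q t) \<longrightarrow> (\<exists>q\<in>Q. P q t \<and> l t = b q)" by blast
    have "total_recursive 1 (\<lambda>xs. if P q (xs ! 0) then b q else l (xs ! 0))"
      by (intro recursive_if assms(2) recursive_const l(1))
    then show ?case using l(2)
      by (intro exI[of _ "\<lambda>t. if P q t then b q else l t"]) auto
  qed
  with that assms(3) show ?thesis by blast
qed

section \<open>Invariance of algorithmic information content\<close>

lemma power_length_le_str_code: "2 ^ length p \<le> str_code p + 1"
  by (induction p rule: rev_induct) auto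

lemma str_decode_str_code [simp]: "str_decode (str_code p) = p"
  using bij_str_code by (simp add: bij_is_inj)

lemma str_code_str_decode [simp]: "str_code (str_decode n) = n"
  using bij_str_code by (simp add: bij_is_surj surj_f_inv_f)

text \<open>
  Regard a partial recursive \<open>G\<close> on numbers as a machine whose programs are strings, read through
  \<open>str_code\<close>. Its index costs a constant, and the string with number \<open>z\<close> has at most
  \<open>log 2 (z + 1)\<close> digits. So upper bounds on complexity reduce to producing small numerical codes.
\<close>

lemma AIC_invariance:
  assumes "recursive_enumeration A" and "universal_machine A U"
    and G: "partial_recursive 1 (\<lambda>xs. G (xs ! 0))"
  obtains c where "\<And>z y. G z = Some y \<Longrightarrow> real (AIC U (str_decode y)) \<le> c + log 2 (real z + 1)"
proof -
  define F where "F p = map_option str_decode (G (str_code p))" for p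
  have "machine F"
    using G unfolding machine_def F_def by (simp add: option.map_comp o_def option.map_ident)
  then have "F \<in> A ` {1..}"
    using assms(1) by (simp add: recursive_enumeration_def)
  then obtain m where m: "m \<ge> 1" "A m = F" by auto
  define h where "h = str_hat (str_decode m)"
  have "real (AIC U (str_decode y)) \<le> real (length h) + log 2 (real z + 1)" if "G z = Some y" for z y
  proof -
    have "F (str_decode z) = Some (str_decode y)" using that by (simp add: F_def)
    then have "U (h @ str_decode z) = Some (str_decode y)"
      using assms(2) m by (auto simp: universal_machine_def h_def)
    then have "AIC U (str_decode y) \<le> length (h @ str_decode z)"
      unfolding AIC_def by (blast intro: Least_le)
    moreover have "real (length (str_decode z)) \<le> log 2 (real z + 1)"
    proof -
      have "(2::nat) ^ length (str_decode z) \<le> z + 1"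
        using power_length_le_str_code[of "str_decode z"] by simp
      then have "real (2 ^ length (str_decode z)) \<le> real (z + 1)" by (rule of_nat_mono)
      then have "2 powr real (length (str_decode z)) \<le> real z + 1"
        by (simp add: powr_realpow add.commute)
      then show ?thesis by (subst le_log_iff) auto
    qed
    ultimately show ?thesis by simp
  qed
  with that show ?thesis by blast
qed

section \<open>Computing with ideal points\<close>

text \<open>
  Comparison of a rational with a power of \<open>1/2\<close>, expressed on its code. The first component of the
  code is odd exactly if the numerator is negative, and otherwise is twice the numerator.
\<close>

lemma rat_less_power_half_iff:
  "q < (1 / 2) ^ m \<longleftrightarrow>
    \<not> (fst (prod_decode (rat_code q)) mod 2 = 0) \<or>
    fst (prod_decode (rat_code q)) div 2 * 2 ^ m < snd (prod_decode (rat_code q))"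
proof -
  obtain a b where ab: "quotient_of q = (a, b)" by fastforce
  have b: "b > 0" using ab by (rule quotient_of_denom_pos)
  have q: "q = of_int a / of_int b" using ab by (rule quotient_of_div)
  have "(of_int a :: rat) / of_int b < 1 / 2 ^ m \<longleftrightarrow> of_int a * 2 ^ m < (of_int b :: rat)"
    using b by (simp add: divide_less_eq less_divide_eq)
  then have "q < (1 / 2) ^ m \<longleftrightarrow> (of_int a :: rat) * 2 ^ m < of_int b"
    unfolding q power_one_over .
  also have "\<dots> \<longleftrightarrow> a * 2 ^ m < b"
    unfolding of_int_less_iff[of "a * 2 ^ m" b, where 'a = rat, symmetric] by simp
  also have "\<dots> \<longleftrightarrow> a < 0 \<or> nat a * 2 ^ m < nat b"
  proof (cases "a < 0")
    case True
    then have "a * 2 ^ m < 0" by (simp add: mult_neg_pos)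
    with b True show ?thesis by linarith
  next
    case False
    then obtain c where c: "a = int c" by (metis nonneg_int_cases not_less)
    have "int c * 2 ^ m < b \<longleftrightarrow> int (c * 2 ^ m) < b" by simp
    also have "\<dots> \<longleftrightarrow> c * 2 ^ m < nat b" using b by linarith
    finally show ?thesis using c by simp
  qed
  finally show ?thesis
    using b by (auto simp: rat_code_def ab int_encode_def sum_encode_def mod_2_eq_odd)
qed

text \<open>
  Comparing the approximation of precision \<open>2^-(n + 2)\<close> with \<open>2^-(n + 1)\<close> errs only for distances
  between \<open>2^-(n + 2)\<close> and \<open>2^-n\<close>. From here on, this test is the only access to distances.
\<close>

lemma computable_dist_gap_decider:
  assumes "computable_dist I J"
  obtains P where "decidable_rel 3 (\<lambda>xs. P (xs ! 0) (xs ! 1) (xs ! 2))"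
    and "\<And>s t n. P s t n \<Longrightarrow> dist (I (str_decode s)) (J (str_decode t)) < (1 / 2) ^ n"
    and "\<And>s t n. \<not> P s t n \<Longrightarrow> (1 / 2) ^ (n + 2) \<le> dist (I (str_decode s)) (J (str_decode t))"
proof -
  obtain D where D: "total_recursive 3
      (\<lambda>xs. rat_code (D (str_decode (xs ! 0)) (str_decode (xs ! 1)) (xs ! 2)))"
    and err: "\<And>s t n. \<bar>dist (I s) (J t) - real_of_rat (D s t n)\<bar> \<le> (1 / 2) ^ n"
    using assms unfolding computable_dist_def total_recursive_rat_def by blast
  define P where "P s t n \<longleftrightarrow> D (str_decode s) (str_decode t) (n + 2) < (1 / 2) ^ (n + 1)" for s t n
  have "decidable_rel 3 (\<lambda>xs. P (xs ! 0) (xs ! 1) (xs ! 2))"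
    unfolding P_def rat_less_power_half_iff
    by (intro decidable_disj decidable_not decidable_eq decidable_less recursive_mult recursive_power recursive_mod recursive_div recursive_add recursive_prod_decode
        recursive_apply3[OF D] recursive_basic) auto
  moreover
  have pow: "(1 / 2) ^ (n + 1) = (1 / 2) ^ n / (2::real)" "(1 / 2) ^ (n + 2) = (1 / 2) ^ n / (4::real)"
    for n by simp_all
  have "dist (I (str_decode s)) (J (str_decode t)) < (1 / 2) ^ n" if "P s t n" for s t n
  proof -
    have "real_of_rat (D (str_decode s) (str_decode t) (n + 2)) < real_of_rat ((1 / 2) ^ (n + 1))"
      using that unfolding P_def by (simp only: of_rat_less)
    then have "real_of_rat (D (str_decode s) (str_decode t) (n + 2)) < (1 / 2) ^ (n + 1)"
      by (simp add: of_rat_mult of_rat_power of_rat_divide)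
    with err[of "str_decode s" "str_decode t" "n + 2"] pow[of n] show ?thesis
      by linarith
  qed
  moreover have "(1 / 2) ^ (n + 2) \<le> dist (I (str_decode s)) (J (str_decode t))" if "\<not> P s t n" for s t n
  proof -
    have "real_of_rat ((1 / 2) ^ (n + 1)) \<le> real_of_rat (D (str_decode s) (str_decode t) (n + 2))"
      using that unfolding P_def by (simp only: of_rat_less_eq not_less)
    then have "(1 / 2) ^ (n + 1) \<le> real_of_rat (D (str_decode s) (str_decode t) (n + 2))"
      by (simp add: of_rat_mult of_rat_power of_rat_divide)
    with err[of "str_decode s" "str_decode t" "n + 2"] pow[of n] show ?thesis
      by linarith
  qed
  ultimately show ?thesis by (rule that)
qed

lemma dense_ideal_points:
  assumes "computable_interpretation I" and "e > 0"
  shows "\<exists>t. dist y (I (str_decode t)) < e"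
proof -
  have "y \<in> closure (range I)" using assms(1) by (simp add: computable_interpretation_def)
  then obtain z where "z \<in> range I" "dist z y < e"
    using assms(2) unfolding closure_approachable by blast
  then show ?thesis by (metis dist_commute imageE str_decode_str_code)
qed

text \<open>
  One step of the orbit is followed by searching for an ideal point close to the image of the current
  ideal point. To keep the error below \<open>2^-n\<close> after \<open>k\<close> steps, the precisions \<open>G n i\<close> demanded
  \<open>i\<close> steps before the end are found by iterating the modulus of continuity backwards from \<open>n\<close>.
\<close>

lemma constructive_approximates_orbits:
  assumes I: "computable_interpretation I" "I \<in> \<I>" and T: "constructive \<I> T"
  obtains q where "total_recursive 3 (\<lambda>xs. q (xs ! 0) (xs ! 1) (xs ! 2))"
    and "\<And>s k n. dist (I (str_decode (q s k n))) ((T ^^ k) (I (str_decode s))) < (1 / 2) ^ n"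
proof -
  have "computable_dist (T \<circ> I) I"
    using I T by (auto simp: constructive_def computable_morphism_def)
  then obtain P where P: "decidable_rel 3 (\<lambda>xs. P (xs ! 0) (xs ! 1) (xs ! 2))"
    and P1: "\<And>s t n. P s t n \<Longrightarrow> dist (T (I (str_decode s))) (I (str_decode t)) < (1 / 2) ^ n"
    and P2: "\<And>s t n. \<not> P s t n \<Longrightarrow> (1 / 2) ^ (n + 2) \<le> dist (T (I (str_decode s))) (I (str_decode t))"
    by (rule computable_dist_gap_decider) auto
  obtain g where g: "total_recursive 1 (\<lambda>xs. g (xs ! 0))"
    and cont: "\<And>x y n. dist x y < (1 / 2) ^ g n \<Longrightarrow> dist (T x) (T y) < (1 / 2) ^ n"
    using T by (auto simp: constructive_def effectively_uniformly_continuous_def)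
  have Pex: "\<exists>t. P s t n" for s n
  proof -
    obtain t where "dist (T (I (str_decode s))) (I (str_decode t)) < (1 / 2) ^ (n + 2)"
      using dense_ideal_points[OF I(1), of "(1 / 2) ^ (n + 2)"] by auto
    then have "P s t n" using P2 by (metis not_less)
    then show ?thesis ..
  qed
  define step where "step s n = (LEAST t. P s t n)" for s n
  have step: "dist (T (I (str_decode s))) (I (str_decode (step s n))) < (1 / 2) ^ n" for s n
    unfolding step_def by (rule P1, rule LeastI_ex, rule Pex)
  have recursive_step: "total_recursive 2 (\<lambda>xs. step (xs ! 0) (xs ! 1))"
    unfolding step_def
    by (intro recursive_Least Pex decidable_apply3[OF P] recursive_basic) auto
  define G where "G n i = rec_nat n (\<lambda>_ m. g (Suc m)) i" for n i
  have G: "G n 0 = n" "G n (Suc i) = g (Suc (G n i))" for n i by (simp_all add: G_def)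
  have recursive_G: "total_recursive 2 (\<lambda>xs. G (xs ! 0) (xs ! 1))"
    unfolding G_def by (intro recursive_rec_nat recursive_apply1[OF g] recursive_basic) auto
  define r where "r s k n i = rec_nat s (\<lambda>i u. step u (Suc (G n (k - Suc i)))) i" for s k n i
  have r: "r s k n 0 = s" "r s k n (Suc i) = step (r s k n i) (Suc (G n (k - Suc i)))" for s k n i
    by (simp_all add: r_def)
  have "dist (I (str_decode (r s k n i))) ((T ^^ i) (I (str_decode s))) < (1 / 2) ^ G n (k - i)"
    if "i \<le> k" for s k n i
    using that
  proof (induction i)
    case 0
    then show ?case by (simp add: r)
  next
    case (Suc i)
    let ?m = "G n (k - Suc i)"
    have "k - i = Suc (k - Suc i)" using Suc.prems by simp
    then have "dist (I (str_decode (r s k n i))) ((T ^^ i) (I (str_decode s))) < (1 / 2) ^ g (Suc ?m)"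
      using Suc by (simp add: G)
    then have "dist (T (I (str_decode (r s k n i)))) ((T ^^ Suc i) (I (str_decode s))) < (1 / 2) ^ Suc ?m"
      using cont by fastforce
    moreover have "dist (T (I (str_decode (r s k n i)))) (I (str_decode (r s k n (Suc i)))) < (1 / 2) ^ Suc ?m"
      using step by (simp only: r)
    ultimately show ?case
      using dist_triangle3[of "I (str_decode (r s k n (Suc i)))" "(T ^^ Suc i) (I (str_decode s))"
          "T (I (str_decode (r s k n i)))"] by simp
  qed
  from this[of k k for k] have
    "dist (I (str_decode (r s k n k))) ((T ^^ k) (I (str_decode s))) < (1 / 2) ^ n" for s k n
    by (simp add: G)
  moreover have "total_recursive 3 (\<lambda>xs. r (xs ! 0) (xs ! 1) (xs ! 2) (xs ! 1))"
    unfolding r_def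
    by (intro recursive_rec_nat recursive_apply2[OF recursive_step] recursive_apply2[OF recursive_G] recursive_diff recursive_basic) auto
  ultimately show ?thesis using that[of "\<lambda>s k n. r s k n k"] by blast
qed

section \<open>Short codes for triples of numbers\<close>

lemma exists_bit_length:
  obtains l where "u < 2 ^ l" and "2 ^ l \<le> 2 * u + (1::nat)"
proof -
  let ?l = "LEAST l. u < 2 ^ l"
  have "u < 2 ^ ?l" by (rule LeastI[of _ u]) (rule less_exp)
  moreover have "2 ^ ?l \<le> 2 * u + 1"
  proof (cases ?l)
    case (Suc l)
    then have "\<not> u < 2 ^ l" by (metis lessI not_less_Least)
    with Suc show ?thesis by simp
  qed simp
  ultimately show ?thesis by (rule that)
qed

text \<open>
  A pairing that costs \<open>2 log u + log v\<close> bits, whereas the Cantor pairing costs twice the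
  logarithm of the larger component. With \<open>l\<close> the number of binary digits of \<open>u\<close>, the code is
  \<open>(2 * (v * 2^l + u) + 1) * 2^l\<close>: the multiplicity of \<open>2\<close> in it reveals \<open>l\<close>, which then
  separates \<open>u\<close> from \<open>v\<close>.
\<close>

lemma asymmetric_pairing:
  obtains \<pi>1 \<pi>2 where "total_recursive 1 (\<lambda>xs. \<pi>1 (xs ! 0))" and "total_recursive 1 (\<lambda>xs. \<pi>2 (xs ! 0))"
    and "\<And>u v. \<exists>z. \<pi>1 z = u \<and> \<pi>2 z = v \<and> z + 1 \<le> 2 * (v + 1) * (2 * u + 1) ^ 2"
proof -
  define val where "val z = (LEAST l. z = 0 \<or> z div 2 ^ l mod 2 \<noteq> 0)" for z :: nat
  define body where "body z = z div 2 ^ val z div 2" for z :: nat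
  define \<pi>1 where "\<pi>1 z = body z mod 2 ^ val z" for z
  define \<pi>2 where "\<pi>2 z = body z div 2 ^ val z" for z
  have ex: "\<exists>l. z = 0 \<or> z div 2 ^ l mod 2 \<noteq> 0" for z :: nat
  proof (induction z rule: less_induct)
    case (less z)
    show ?case
    proof (cases "z mod 2 = 0 \<and> z > 0")
      case True
      then obtain l where "z div 2 = 0 \<or> z div 2 div 2 ^ l mod 2 \<noteq> 0"
        using less[of "z div 2"] by auto
      then have "z div 2 ^ Suc l mod 2 \<noteq> 0" using True by (auto simp: div_mult2_eq)
      then show ?thesis by blast
    qed (auto intro: exI[of _ 0])
  qed
  have recursive_val: "total_recursive 1 (\<lambda>xs. val (xs ! 0))"
    unfolding val_def
    by (intro recursive_Least ex decidable_disj decidable_not decidable_eq recursive_div recursive_mod recursive_power recursive_basic) auto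
  have recursive_body: "total_recursive 1 (\<lambda>xs. body (xs ! 0))"
    unfolding body_def by (intro recursive_div recursive_power recursive_apply1[OF recursive_val] recursive_basic) auto
  have "total_recursive 1 (\<lambda>xs. \<pi>1 (xs ! 0))"
    unfolding \<pi>1_def by (intro recursive_mod recursive_power recursive_apply1[OF recursive_val] recursive_apply1[OF recursive_body] recursive_basic) auto
  moreover have "total_recursive 1 (\<lambda>xs. \<pi>2 (xs ! 0))"
    unfolding \<pi>2_def by (intro recursive_div recursive_power recursive_apply1[OF recursive_val] recursive_apply1[OF recursive_body] recursive_basic) auto
  moreover have "\<exists>z. \<pi>1 z = u \<and> \<pi>2 z = v \<and> z + 1 \<le> 2 * (v + 1) * (2 * u + 1) ^ 2" for u v
  proof -
    obtain l where l: "u < 2 ^ l" "2 ^ l \<le> 2 * u + 1" by (rule exists_bit_length)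
    define w where "w = v * 2 ^ l + u"
    define z where "z = (2 * w + 1) * 2 ^ l"
    have "val z = l"
      unfolding val_def
    proof (rule Least_equality)
      show "z = 0 \<or> z div 2 ^ l mod 2 \<noteq> 0" by (simp add: z_def)
      fix m assume m: "z = 0 \<or> z div 2 ^ m mod 2 \<noteq> 0"
      show "l \<le> m"
      proof (rule ccontr)
        assume "\<not> l \<le> m"
        then obtain d where "l = m + Suc d" using less_imp_Suc_add by (metis add_Suc_right not_le)
        then have "z = (2 * ((2 * w + 1) * 2 ^ d)) * 2 ^ m" by (simp add: z_def power_add algebra_simps)
        then have "z div 2 ^ m mod 2 = 0" by simp
        with m show False by (simp add: z_def)
      qed
    qed
    then have "body z = w" by (simp add: body_def z_def)
    with \<open>val z = l\<close> l(1) have "\<pi>1 z = u" "\<pi>2 z = v"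
      by (simp_all add: \<pi>1_def \<pi>2_def w_def)
    moreover have "z + 1 \<le> 2 * (v + 1) * (2 * u + 1) ^ 2"
    proof -
      have "w + 1 \<le> (v + 1) * 2 ^ l" using l(1) by (simp add: w_def)
      then have "2 * w + 2 \<le> 2 * ((v + 1) * 2 ^ l)" by linarith
      then have "(2 * w + 2) * 2 ^ l \<le> 2 * ((v + 1) * 2 ^ l) * 2 ^ l" by (rule mult_right_mono) simp
      moreover have "z + 1 \<le> (2 * w + 2) * 2 ^ l" by (simp add: z_def)
      ultimately have "z + 1 \<le> 2 * (v + 1) * (2 ^ l * 2 ^ l)" by (simp add: ac_simps)
      also have "\<dots> \<le> 2 * (v + 1) * ((2 * u + 1) * (2 * u + 1))"
        by (intro mult_left_mono mult_mono l(2)) auto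
      finally show ?thesis by (simp add: power2_eq_square)
    qed
    ultimately show ?thesis by blast
  qed
  ultimately show ?thesis by (rule that)
qed

text \<open>
  Only \<open>n\<close> and \<open>k\<close> are to be charged with coefficient \<open>1\<close>. They are glued as
  \<open>k * 2^L + n\<close>, and the cheap number \<open>L\<close>, of size \<open>log n\<close>, joins \<open>j\<close> in the expensive
  component of \<open>asymmetric_pairing\<close>.
\<close>

lemma triple_coding:
  obtains cj cn ck where "total_recursive 1 (\<lambda>xs. cj (xs ! 0))"
    and "total_recursive 1 (\<lambda>xs. cn (xs ! 0))" and "total_recursive 1 (\<lambda>xs. ck (xs ! 0))"
    and "\<And>j n k. \<exists>z. cj z = j \<and> cn z = n \<and> ck z = k \<and>
      log 2 (real z + 1) \<le> 3 + log 2 (real k + 1) + log 2 (2 * real n + 1)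
        + 4 * log 2 (real j + log 2 (2 * real n + 1) + 1)"
proof -
  obtain \<pi>1 \<pi>2 where \<pi>: "total_recursive 1 (\<lambda>xs. \<pi>1 (xs ! 0))" "total_recursive 1 (\<lambda>xs. \<pi>2 (xs ! 0))"
    and pair: "\<And>u v. \<exists>z. \<pi>1 z = u \<and> \<pi>2 z = v \<and> z + 1 \<le> 2 * (v + 1) * (2 * u + 1) ^ 2"
    by (rule asymmetric_pairing) blast
  define cj where "cj z = fst (prod_decode (\<pi>1 z))" for z
  define cL where "cL z = snd (prod_decode (\<pi>1 z))" for z
  define cn where "cn z = \<pi>2 z mod 2 ^ cL z" for z
  define ck where "ck z = \<pi>2 z div 2 ^ cL z" for z
  have recursive_cj: "total_recursive 1 (\<lambda>xs. cj (xs ! 0))"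
    unfolding cj_def by (intro recursive_prod_decode recursive_apply1[OF \<pi>(1)] recursive_basic) auto
  have recursive_cL: "total_recursive 1 (\<lambda>xs. cL (xs ! 0))"
    unfolding cL_def by (intro recursive_prod_decode recursive_apply1[OF \<pi>(1)] recursive_basic) auto
  have recursive_cn: "total_recursive 1 (\<lambda>xs. cn (xs ! 0))"
    unfolding cn_def by (intro recursive_mod recursive_power recursive_apply1[OF \<pi>(2)] recursive_apply1[OF recursive_cL] recursive_basic) auto
  have recursive_ck: "total_recursive 1 (\<lambda>xs. ck (xs ! 0))"
    unfolding ck_def by (intro recursive_div recursive_power recursive_apply1[OF \<pi>(2)] recursive_apply1[OF recursive_cL] recursive_basic) auto
  have "\<exists>z. cj z = j \<and> cn z = n \<and> ck z = k \<and>
      log 2 (real z + 1) \<le> 3 + log 2 (real k + 1) + log 2 (2 * real n + 1)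
        + 4 * log 2 (real j + log 2 (2 * real n + 1) + 1)" for j n k
  proof -
    obtain L where L: "n < 2 ^ L" "2 ^ L \<le> 2 * n + 1" by (rule exists_bit_length)
    define u where "u = prod_encode (j, L)"
    define v where "v = k * 2 ^ L + n"
    obtain z where z: "\<pi>1 z = u" "\<pi>2 z = v" "z + 1 \<le> 2 * (v + 1) * (2 * u + 1) ^ 2"
      using pair by blast
    have "cL z = L" "cj z = j" by (simp_all add: cL_def cj_def z u_def)
    with L(1) have "cn z = n" "ck z = k" by (simp_all add: cn_def ck_def z v_def)
    define s where "s = j + L"
    have "2 * triangle s = s * (s + 1)" by (simp add: triangle_def)
    then have "2 * u \<le> s * (s + 1) + 2 * s" by (simp add: u_def prod_encode_def s_def)
    then have u: "2 * u + 1 \<le> 2 * (s + 1) ^ 2" by (simp add: power2_eq_square algebra_simps)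
    have "v + 1 \<le> (k + 1) * 2 ^ L" using L(1) by (simp add: v_def)
    also have "\<dots> \<le> (k + 1) * (2 * n + 1)" using L(2) by (rule mult_left_mono) simp
    finally have v: "v + 1 \<le> (k + 1) * (2 * n + 1)" .
    have "z + 1 \<le> 2 * ((k + 1) * (2 * n + 1)) * (2 * (s + 1) ^ 2) ^ 2"
      using z(3) by (rule order_trans) (intro mult_mono power_mono u v; simp)
    then have "real (z + 1) \<le> real (2 * ((k + 1) * (2 * n + 1)) * (2 * (s + 1) ^ 2) ^ 2)"
      by (rule of_nat_mono)
    then have "real z + 1 \<le> 2 ^ 3 * ((real k + 1) * ((2 * real n + 1) * (real s + 1) ^ 4))"
      by (simp add: power_mult_distrib algebra_simps flip: power_mult)
    then have "log 2 (real z + 1) \<le> log 2 (2 ^ 3 * ((real k + 1) * ((2 * real n + 1) * (real s + 1) ^ 4)))"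
      by (intro log_mono) auto
    also have "\<dots> = 3 + log 2 (real k + 1) + log 2 (2 * real n + 1) + 4 * log 2 (real s + 1)"
    proof -
      have [simp]: "real k + 1 \<noteq> 0" "2 * real n + 1 \<noteq> 0" "real s + 1 > 0" "real s + 1 \<noteq> 0"
        by linarith+
      have "log 2 ((real s + 1) ^ 4) = 4 * log 2 (real s + 1)" by (subst log_nat_power) auto
      moreover have "log 2 ((2::real) ^ 3) = 3" by (subst log_nat_power) auto
      ultimately show ?thesis by (simp add: log_mult)
    qed
    also have "log 2 (real s + 1) \<le> log 2 (real j + log 2 (2 * real n + 1) + 1)"
    proof (intro log_mono)
      have "real (2 ^ L) \<le> real (2 * n + 1)" using L(2) by (rule of_nat_mono)
      then have "2 powr real L \<le> 2 * real n + 1" by (simp add: powr_realpow)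
      then have "real L \<le> log 2 (2 * real n + 1)" by (subst le_log_iff) auto
      then show "real s + 1 \<le> real j + log 2 (2 * real n + 1) + 1" by (simp add: s_def)
    qed auto
    finally have "log 2 (real z + 1) \<le> 3 + log 2 (real k + 1) + log 2 (2 * real n + 1)
        + 4 * log 2 (real j + log 2 (2 * real n + 1) + 1)" by simp
    with \<open>cj z = j\<close> \<open>cn z = n\<close> \<open>ck z = k\<close> show ?thesis by blast
  qed
  with recursive_cj recursive_cn recursive_ck show ?thesis by (rule that)
qed

section \<open>Greedy nets and covering numbers\<close>

text \<open>
  Read \<open>R j s t\<close> as a test for \<open>s\<close> and \<open>t\<close> being close at scale \<open>j\<close>. The recursion for
  \<open>N j t\<close> refers to all earlier values; it becomes a primitive recursion by storing the
  finite set of kept indices below \<open>t\<close> as the binary digits of a number.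
\<close>

lemma decidable_greedy_net:
  assumes R: "decidable_rel 3 (\<lambda>xs. R (xs ! 0) (xs ! 1) (xs ! 2))"
  obtains N where "decidable_rel 2 (\<lambda>xs. N (xs ! 0) (xs ! 1))"
    and "\<And>j t. N j t \<longleftrightarrow> \<not> (\<exists>s<t. N j s \<and> R j s t)"
proof -
  define M :: "nat \<Rightarrow> nat \<Rightarrow> nat" where "M j t =
      rec_nat 0 (\<lambda>t m. if \<exists>s<t. m div 2 ^ s mod 2 \<noteq> 0 \<and> R j s t then m else 2 ^ t + m) t" for j t
  define N where "N j t \<longleftrightarrow> M j (Suc t) div 2 ^ t mod 2 \<noteq> 0" for j t
  have recursive_M: "total_recursive 2 (\<lambda>xs. M (xs ! 0) (xs ! 1))"
    unfolding M_def
    by (intro recursive_rec_nat recursive_if decidable_bex decidable_conj decidable_not decidable_eq recursive_mod recursive_div recursive_power recursive_add decidable_apply3[OF R]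
        recursive_basic) auto
  have decidable_N: "decidable_rel 2 (\<lambda>xs. N (xs ! 0) (xs ! 1))"
    unfolding N_def
    by (intro decidable_not decidable_eq recursive_mod recursive_div recursive_power recursive_apply2[OF recursive_M] recursive_basic) auto
  have bit: "m div 2 ^ s mod 2 \<noteq> 0 \<longleftrightarrow> s \<in> set_decode m" for m s :: nat
    by (simp add: set_decode_def mod_2_eq_odd)
  have M_Suc: "M j (Suc t) = (if \<exists>s<t. s \<in> set_decode (M j t) \<and> R j s t then M j t else 2 ^ t + M j t)" for j t
    by (simp only: M_def nat.rec bit)
  have M_set_Suc: "set_decode (M j (Suc t)) =
      (if \<exists>s<t. s \<in> set_decode (M j t) \<and> R j s t then set_decode (M j t)
       else insert t (set_decode (M j t)))" if "t \<notin> set_decode (M j t)" for j t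
    by (simp only: M_Suc if_distrib[of set_decode] set_decode_plus_power_2[OF that])
  have M_set: "set_decode (M j t) = {s. s < t \<and> N j s}" for j t
  proof (induction t)
    case 0
    show ?case by (simp add: M_def)
  next
    case (Suc t)
    then have "t \<notin> set_decode (M j t)" by simp
    then have "set_decode (M j (Suc t)) = set_decode (M j t)
        \<or> set_decode (M j (Suc t)) = insert t (set_decode (M j t))"
      using M_set_Suc[of t j] by argo
    moreover have "t \<in> set_decode (M j (Suc t)) \<longleftrightarrow> N j t" by (simp only: N_def bit)
    ultimately have "set_decode (M j (Suc t)) = {s. s < t \<and> N j s} \<union> {s. s = t \<and> N j s}"
      using Suc by auto
    then show ?case by (auto simp: less_Suc_eq)
  qed
  have "N j t \<longleftrightarrow> \<not> (\<exists>s<t. N j s \<and> R j s t)" for j t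
  proof -
    have "t \<notin> set_decode (M j t)" by (simp add: M_set)
    moreover have "N j t \<longleftrightarrow> t \<in> set_decode (M j (Suc t))" by (simp add: M_set)
    ultimately have "N j t \<longleftrightarrow> \<not> (\<exists>s<t. s \<in> set_decode (M j t) \<and> R j s t)"
      using M_set_Suc[of t j] by (metis insertI1)
    then show ?thesis by (auto simp: M_set)
  qed
  with decidable_N show ?thesis by (rule that)
qed


lemma covering_number_attained:
  fixes F :: "'a::metric_space set"
  assumes "compact (UNIV :: 'a set)" and "\<rho> > 0"
  obtains C where "finite C" "card C = covering_number \<rho> F" "F \<subseteq> (\<Union>c\<in>C. ball c \<rho>)"
proof -
  have "(UNIV :: 'a set) \<subseteq> (\<Union>c\<in>UNIV. ball c \<rho>)"
    using assms(2) centre_in_ball by blast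
  then obtain C where "finite C" "(UNIV :: 'a set) \<subseteq> (\<Union>c\<in>C. ball c \<rho>)"
    by (rule compactE_image[OF assms(1), rotated]) auto
  then have "\<exists>C. finite C \<and> card C = card C \<and> F \<subseteq> (\<Union>c\<in>C. ball c \<rho>)" by blast
  then have "\<exists>n C. finite C \<and> card C = n \<and> F \<subseteq> (\<Union>c\<in>C. ball c \<rho>)" by blast
  from LeastI_ex[OF this] that show ?thesis unfolding covering_number_def by blast
qed

text \<open>
  A ball of radius \<open>\<rho>\<close> contains at most one point of a \<open>2 * \<rho>\<close>-separated family.
\<close>

lemma card_separated_le_covering_number:
  fixes y :: "'b \<Rightarrow> 'a::metric_space"
  assumes "compact (UNIV :: 'a set)" and "\<rho> > 0" and "y ` K \<subseteq> F"
    and sep: "\<And>s t. s \<in> K \<Longrightarrow> t \<in> K \<Longrightarrow> s \<noteq> t \<Longrightarrow> 2 * \<rho> \<le> dist (y s) (y t)"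
  shows "card K \<le> covering_number \<rho> F"
proof -
  obtain C where C: "finite C" "card C = covering_number \<rho> F" "F \<subseteq> (\<Union>c\<in>C. ball c \<rho>)"
    using covering_number_attained[OF assms(1,2)] by blast
  have "\<exists>c\<in>C. dist c (y s) < \<rho>" if "s \<in> K" for s
    using that assms(3) C(3) by (auto simp: subset_iff)
  then obtain c where c: "\<And>s. s \<in> K \<Longrightarrow> c s \<in> C \<and> dist (c s) (y s) < \<rho>" by metis
  have "inj_on c K"
  proof (rule inj_onI)
    fix s t assume st: "s \<in> K" "t \<in> K" "c s = c t"
    show "s = t"
    proof (rule ccontr)
      assume "s \<noteq> t"
      with sep st have "2 * \<rho> \<le> dist (y s) (y t)" by blast
      then show False
        using dist_triangle3[of "y s" "y t" "c s"] c[OF st(1)] c[OF st(2)] st(3) by simp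
    qed
  qed
  then have "card K \<le> card C" using c C(1) by (intro card_inj_on_le) auto
  with C(2) show ?thesis by simp
qed

section \<open>Short descriptions of itineraries\<close>

text \<open>
  The machine receives \<open>n\<close>, \<open>j\<close> and \<open>k\<close>, searches the \<open>k\<close>-th index \<open>t\<close> of the greedy net
  of mesh \<open>2^-(j + 1)\<close>, follows the orbit of \<open>y t\<close> for \<open>n\<close> steps with precision
  \<open>\<epsilon>\<close>, and translates it into letters by a finite table. A suitable \<open>k\<close> makes the outcome
  the beginning of an itinerary of \<open>x\<close>. The precision depends on the cover only, so that it
  is part of the machine and not of the program.
\<close>

lemma itinerary_complexity_bound:
  fixes F :: "'a::metric_space set" and T :: "'a \<Rightarrow> 'a"
  assumes "recursive_enumeration A" and "universal_machine A U" and E: "word_encoding E"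
    and cpt: "compact (UNIV :: 'a set)"
    and I: "computable_interpretation I" "I \<in> \<I>" and T: "constructive \<I> T"
    and a: "total_recursive 1 (\<lambda>xs. a (xs ! 0))" and b: "total_recursive 1 (\<lambda>xs. b (xs ! 0))"
    and y_def: "\<And>t. y t = (T ^^ a t) (I (str_decode (b t)))"
    and F: "range y \<subseteq> F" and x: "x \<in> closure (range y)"
    and cover: "finite_open_cover \<beta>"
  obtains c \<epsilon> where "\<epsilon> > 0"
    and "\<And>n j. ball x ((1 / 2) ^ j) \<subseteq> dyn_ball T n x \<epsilon> \<Longrightarrow>
      \<exists>\<omega>\<in>itineraries T \<beta> x. real (word_AIC U E (length \<beta>) (prefix_word \<omega> n)) \<le>
        c + log 2 (real (covering_number ((1 / 2) ^ (j + 6)) F)) + log 2 (2 * real n + 1)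
          + 4 * log 2 (real j + log 2 (2 * real n + 1) + 1)"
proof -
  define J where "J t = I (str_decode t)" for t
  obtain q where q: "total_recursive 3 (\<lambda>xs. q (xs ! 0) (xs ! 1) (xs ! 2))"
    and q_dist: "\<And>s k n. dist (J (q s k n)) ((T ^^ k) (J s)) < (1 / 2) ^ n"
    using constructive_approximates_orbits[OF I T] unfolding J_def by blast
  have "computable_dist I I" using I(1) by (simp add: computable_interpretation_def)
  then obtain P where P: "decidable_rel 3 (\<lambda>xs. P (xs ! 0) (xs ! 1) (xs ! 2))"
    and near: "\<And>s t n. P s t n \<Longrightarrow> dist (J s) (J t) < (1 / 2) ^ n"
    and far: "\<And>s t n. \<not> P s t n \<Longrightarrow> (1 / 2) ^ (n + 2) \<le> dist (J s) (J t)"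
    using computable_dist_gap_decider unfolding J_def by blast

  have "UNIV \<subseteq> \<Union>(set \<beta>)" and "\<And>B. B \<in> set \<beta> \<Longrightarrow> open B"
    using cover by (auto simp: finite_open_cover_def)
  from Heine_Borel_lemma[OF cpt this] obtain \<epsilon>0 where \<epsilon>0: "\<epsilon>0 > 0"
    "\<And>z. \<exists>B\<in>set \<beta>. ball z \<epsilon>0 \<subseteq> B" by auto
  \<comment> \<open>Three errors of size \<open>\<epsilon>\<close> separate \<open>T^i x\<close> from a point of the table: table to
    approximation, approximation to shadow, shadow to \<open>T^i x\<close>.\<close>
  obtain e where e: "(1 / 2) ^ e < \<epsilon>0 / 3"
    using real_arch_pow_inv[of "\<epsilon>0 / 3" "1 / 2"] \<epsilon>0(1) by auto
  define \<epsilon> :: real where "\<epsilon> = (1 / 2) ^ e"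
  have "\<epsilon> > 0" by (simp add: \<epsilon>_def)
  have "\<exists>m<length \<beta>. ball (J s) \<epsilon>0 \<subseteq> \<beta> ! m" for s
    using \<epsilon>0(2)[of "J s"] by (metis in_set_conv_nth)
  then obtain m where m: "\<And>s. m s < length \<beta>" "\<And>s. ball (J s) \<epsilon>0 \<subseteq> \<beta> ! m s" by metis
  have "UNIV \<subseteq> (\<Union>s. ball (J s) ((1 / 2) ^ (e + 2)))"
  proof
    fix z
    obtain s where "dist z (J s) < (1 / 2) ^ (e + 2)"
      using dense_ideal_points[OF I(1), of "(1 / 2) ^ (e + 2)" z] by (auto simp: J_def)
    then show "z \<in> (\<Union>s. ball (J s) ((1 / 2) ^ (e + 2)))" by (auto simp: dist_commute)
  qed
  then obtain S where S: "finite S" "UNIV \<subseteq> (\<Union>s\<in>S. ball (J s) ((1 / 2) ^ (e + 2)))"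
    using compactE_image[OF cpt, of UNIV "\<lambda>s. ball (J s) ((1 / 2) ^ (e + 2))"] by auto
  have "\<exists>s\<in>S. P s t e" for t
  proof -
    have "J t \<in> (\<Union>s\<in>S. ball (J s) ((1 / 2) ^ (e + 2)))" using S(2) by blast
    then obtain s where "s \<in> S" "dist (J s) (J t) < (1 / 2) ^ (e + 2)" by auto
    with far show ?thesis by (metis not_less)
  qed
  then obtain l where l: "total_recursive 1 (\<lambda>xs. l (xs ! 0))" "\<And>t. \<exists>s\<in>S. P s t e \<and> l t = m s"
    using recursive_table_lookup[of S "\<lambda>s t. P s t e" m] S(1) decidable_apply3[OF P] recursive_const recursive_nth[of 0 1] by auto
  have letter: "l t < length \<beta>" "dist (J t) z < \<epsilon> \<Longrightarrow> dist z z' \<le> \<epsilon> \<Longrightarrow> z' \<in> \<beta> ! l t" for t z z'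
  proof -
    obtain s where s: "P s t e" "l t = m s" using l(2) by blast
    show "l t < length \<beta>" using s m by simp
    assume "dist (J t) z < \<epsilon>" "dist z z' \<le> \<epsilon>"
    moreover have "dist (J s) (J t) < \<epsilon>" unfolding \<epsilon>_def using s(1) by (rule near)
    ultimately have "dist (J s) z' < \<epsilon>0"
      using dist_triangle[of "J s" z' "J t"] dist_triangle[of "J t" z' z] e by (simp add: \<epsilon>_def)
    then show "z' \<in> \<beta> ! l t" using m(2)[of s] s(2) by auto
  qed

  \<comment> \<open>The two approximation errors \<open>2^-(j + 5)\<close> are small against both thresholds \<open>2^-(j + 1)\<close> and
    \<open>2^-(j + 3)\<close> of the gap decider at level \<open>j + 1\<close>.\<close>
  define R where "R j s t = P (q (b s) (a s) (j + 5)) (q (b t) (a t) (j + 5)) (Suc j)" for j s t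
  have decidable_R: "decidable_rel 3 (\<lambda>xs. R (xs ! 0) (xs ! 1) (xs ! 2))"
    unfolding R_def
    by (intro decidable_apply3[OF P] recursive_apply3[OF q] recursive_apply1[OF a] recursive_apply1[OF b] recursive_add recursive_basic) auto
  have y_approx: "dist (J (q (b t) (a t) n)) (y t) < (1 / 2) ^ n" for t n
    using q_dist by (simp add: y_def J_def)
  have pow: "(1 / 2) ^ (j + 5) = (1 / 2) ^ j / (32::real)" "(1 / 2) ^ (Suc j) = (1 / 2) ^ j / (2::real)"
    "(1 / 2) ^ (Suc j + 2) = (1 / 2) ^ j / (8::real)" "(1 / 2) ^ (j + 4) = (1 / 2) ^ j / (16::real)" 
    "(1 / 2) ^ j > (0::real)" for j
    by (simp_all add: power_add power_divide)
  have R_near: "dist (y s) (y t) < (1 / 2) ^ j" if "R j s t" for j s t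
  proof -
    let ?u = "J (q (b s) (a s) (j + 5))" and ?v = "J (q (b t) (a t) (j + 5))"
    have "dist ?u ?v < (1 / 2) ^ Suc j" using that unfolding R_def by (rule near)
    then show ?thesis
      using y_approx[of s "j + 5"] y_approx[of t "j + 5"] pow[of j]
        dist_triangle3[of "y s" "y t" ?u] dist_triangle[of ?u "y t" ?v] by linarith
  qed
  have R_far: "(1 / 2) ^ (j + 4) \<le> dist (y s) (y t)" if "\<not> R j s t" for j s t
  proof -
    let ?u = "J (q (b s) (a s) (j + 5))" and ?v = "J (q (b t) (a t) (j + 5))"
    have "(1 / 2) ^ (Suc j + 2) \<le> dist ?u ?v" using that unfolding R_def by (rule far)
    then show ?thesis
      using y_approx[of s "j + 5"] y_approx[of t "j + 5"] pow[of j] dist_commute[of "y t" ?v]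
        dist_triangle[of ?u ?v "y s"] dist_triangle[of "y s" ?v "y t"] by linarith
  qed
  obtain N where decidable_N: "decidable_rel 2 (\<lambda>xs. N (xs ! 0) (xs ! 1))"
    and N: "\<And>j t. N j t \<longleftrightarrow> \<not> (\<exists>s<t. N j s \<and> R j s t)"
    using decidable_greedy_net[OF decidable_R] by blast
  have N_sep: "(1 / 2) ^ (j + 4) \<le> dist (y s) (y t)" if "N j s" "N j t" "s \<noteq> t" for j s t
  proof (rule linorder_cases[of s t])
    assume "s < t"
    then show ?thesis using that N R_far by blast
  next
    assume "t < s"
    then show ?thesis using that N R_far dist_commute by metis
  qed (use that in simp)
  have N_covers: "\<exists>s. N j s \<and> dist (y s) (y t) < (1 / 2) ^ j" for j t
  proof (cases "N j t")
    case True
    then show ?thesis by (intro exI[of _ t]) simp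
  next
    case False
    then show ?thesis using N R_near by blast
  qed
  define rank where "rank j t = card {s. s < t \<and> N j s}" for j t
  have recursive_rank: "total_recursive 2 (\<lambda>xs. rank (xs ! 0) (xs ! 1))"
    unfolding rank_def
    by (intro recursive_count_below decidable_N[unfolded decidable_rel_def, THEN recursive_apply2, folded decidable_rel_def]
        recursive_basic) auto
  have rank_mono: "rank j s < rank j t" if "s < t" "N j s" for j s t
    unfolding rank_def using that by (intro psubset_card_mono) auto
  have rank_bound: "Suc (rank j t) \<le> covering_number ((1 / 2) ^ (j + 5)) F" if "N j t" for j t
  proof -
    have "Suc (rank j t) = card (insert t {s. s < t \<and> N j s})" by (simp add: rank_def)
    also have "\<dots> \<le> covering_number ((1 / 2) ^ (j + 5)) F"
    proof (rule card_separated_le_covering_number[OF cpt, where y = y])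
      fix s s' assume "s \<in> insert t {s. s < t \<and> N j s}" "s' \<in> insert t {s. s < t \<and> N j s}" "s \<noteq> s'"
      with that have "(1 / 2) ^ (j + 4) \<le> dist (y s) (y s')" by (intro N_sep) auto
      then show "2 * (1 / 2) ^ (j + 5) \<le> dist (y s) (y s')" by (simp add: power_add power_divide)
    qed (use F in auto)
    finally show ?thesis .
  qed

  have "length \<beta> \<ge> 1" using m(1)[of 0] by linarith
  then obtain h where h: "total_recursive 1 h"
    and h_code: "\<And>w. w \<in> lists {..<length \<beta>} \<Longrightarrow> h [list_encode w] = str_code (E (length \<beta>) w)"
    using E unfolding word_encoding_def by blast
  have recursive_h: "total_recursive 1 (\<lambda>xs. (\<lambda>w. h [w]) (xs ! 0))"
    by (rule total_recursive_cong[OF h]) (auto simp: length_Suc_conv)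
  obtain cj cn ck where cj: "total_recursive 1 (\<lambda>xs. cj (xs ! 0))"
    and cn: "total_recursive 1 (\<lambda>xs. cn (xs ! 0))" and ck: "total_recursive 1 (\<lambda>xs. ck (xs ! 0))"
    and coding: "\<And>j n k. \<exists>z. cj z = j \<and> cn z = n \<and> ck z = k \<and>
      log 2 (real z + 1) \<le> 3 + log 2 (real k + 1) + log 2 (2 * real n + 1)
        + 4 * log 2 (real j + log 2 (2 * real n + 1) + 1)"
    by (rule triple_coding) blast
  define W where "W t n = map (\<lambda>i. l (q (b t) (i + a t) e)) [0..<n]" for t n
  \<comment> \<open>The net is taken one level finer than \<open>j\<close>, since \<open>x\<close> itself is only a limit of points \<open>y t\<close>.\<close>
  define found where "found t z \<longleftrightarrow> N (Suc (cj z)) t \<and> rank (Suc (cj z)) t = ck z" for t z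
  have "decidable_rel 2 (\<lambda>xs. found (xs ! 0) (xs ! 1))"
    unfolding found_def
    by (intro decidable_conj decidable_eq decidable_N[unfolded decidable_rel_def, THEN recursive_apply2, folded decidable_rel_def]
        recursive_apply2[OF recursive_rank] recursive_apply1[OF cj] recursive_apply1[OF ck] recursive_basic) auto
  moreover have "total_recursive 2 (\<lambda>xs. h [list_encode (W (xs ! 0) (cn (xs ! 1)))])"
    unfolding W_def
    by (intro recursive_apply1[OF recursive_h] recursive_list_encode_map recursive_apply1[OF l(1)] recursive_apply3[OF q]
        recursive_apply1[OF a] recursive_apply1[OF b] recursive_apply1[OF cn] recursive_add recursive_basic) auto
  ultimately have "partial_recursive 1 (\<lambda>xs. if \<exists>t. found t (xs ! 0)
      then Some (h [list_encode (W (LEAST t. found t (xs ! 0)) (cn (xs ! 0)))]) else None)"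
    by (rule partial_recursive_search[where H = "\<lambda>t z. h [list_encode (W t (cn z))]"])
  from AIC_invariance[OF assms(1,2) this] obtain c where
    c: "\<And>z y. (if \<exists>t. found t z then Some (h [list_encode (W (LEAST t. found t z) (cn z))]) else None) = Some y
      \<Longrightarrow> real (AIC U (str_decode y)) \<le> c + log 2 (real z + 1)"
    by blast
  have complexity: "real (word_AIC U E (length \<beta>) (W t n)) \<le>
      c + 7 + log 2 (real (covering_number ((1 / 2) ^ (j + 6)) F)) + log 2 (2 * real n + 1)
        + 4 * log 2 (real j + log 2 (2 * real n + 1) + 1)" if t: "N (Suc j) t" for j n t
  proof -
    obtain z where z: "cj z = j" "cn z = n" "ck z = rank (Suc j) t"
      "log 2 (real z + 1) \<le> 3 + log 2 (real (rank (Suc j) t) + 1) + log 2 (2 * real n + 1)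
        + 4 * log 2 (real j + log 2 (2 * real n + 1) + 1)"
      using coding by blast
    have found_iff: "found s z \<longleftrightarrow> s = t" for s
      unfolding found_def z using t rank_mono by (metis linorder_neq_iff)
    have "real (AIC U (str_decode (h [list_encode (W t n)]))) \<le> c + log 2 (real z + 1)"
      by (rule c) (simp add: found_iff z Least_equality[of "\<lambda>s. s = t" t])
    moreover have "str_decode (h [list_encode (W t n)]) = E (length \<beta>) (W t n)"
      by (subst h_code) (auto simp: W_def letter(1))
    moreover have "log 2 (real (rank (Suc j) t) + 1) \<le> log 2 (real (covering_number ((1 / 2) ^ (j + 6)) F))"
      using rank_bound[OF t] by (intro log_mono) (auto simp: add.commute)
    ultimately show ?thesis using z(4) by (simp add: word_AIC_def)
  qed
  have "\<exists>\<omega>\<in>itineraries T \<beta> x. real (word_AIC U E (length \<beta>) (prefix_word \<omega> n)) \<le>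
        c + 7 + log 2 (real (covering_number ((1 / 2) ^ (j + 6)) F)) + log 2 (2 * real n + 1)
          + 4 * log 2 (real j + log 2 (2 * real n + 1) + 1)"
    if ball: "ball x ((1 / 2) ^ j) \<subseteq> dyn_ball T n x \<epsilon>" for n j
  proof -
    obtain s where s: "dist (y s) x < (1 / 2) ^ Suc j"
      using x unfolding closure_approachable by (metis half_gt_zero_iff imageE zero_less_one zero_less_power)
    obtain t where t: "N (Suc j) t" "dist (y t) (y s) < (1 / 2) ^ Suc j"
      using N_covers by blast
    have "dist x (y t) < (1 / 2) ^ j"
      using s t(2) pow(2)[of j] dist_triangle[of "y t" x "y s"] dist_commute[of x "y t"] by linarith
    then have shadow: "y t \<in> dyn_ball T n x \<epsilon>" using ball by auto
    have "\<exists>i<length \<beta>. (T ^^ k) x \<in> \<beta> ! i" for k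
      using cover by (metis UNIV_I UnionE finite_open_cover_def in_set_conv_nth)
    then obtain \<omega>0 where \<omega>0: "\<And>k. \<omega>0 k < length \<beta>" "\<And>k. (T ^^ k) x \<in> \<beta> ! \<omega>0 k" by metis
    \<comment> \<open>The computed word is continued arbitrarily to an infinite itinerary.\<close>
    define \<omega> where "\<omega> i = (if i < n then l (q (b t) (i + a t) e) else \<omega>0 i)" for i
    have "(T ^^ i) x \<in> \<beta> ! l (q (b t) (i + a t) e)" if "i < n" for i
    proof (rule letter(2))
      show "dist (J (q (b t) (i + a t) e)) ((T ^^ i) (y t)) < \<epsilon>"
        using q_dist[of "b t" "i + a t" e] by (simp add: \<epsilon>_def y_def J_def funpow_add)
      show "dist ((T ^^ i) (y t)) ((T ^^ i) x) \<le> \<epsilon>"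
        using shadow that by (simp add: dyn_ball_def)
    qed
    then have "\<omega> \<in> itineraries T \<beta> x"
      by (auto simp: itineraries_def \<omega>_def letter(1) \<omega>0)
    moreover have "prefix_word \<omega> n = W t n" by (simp add: prefix_word_def W_def \<omega>_def)
    ultimately show ?thesis using complexity[OF t(1), of n] by metis
  qed
  with \<open>\<epsilon> > 0\<close> show ?thesis by (rule that)
qed

section \<open>Box dimension and sensitivity along a sequence of scales\<close>

lemma ball_subset_dyn_ball_of_less_sens_radius:
  assumes "ereal r < sens_radius T x n \<epsilon>"
  shows "ball x r \<subseteq> dyn_ball T n x \<epsilon>"
proof -
  obtain r' where "ball x r' \<subseteq> dyn_ball T n x \<epsilon>" "r < r'"
    using assms unfolding sens_radius_def less_SUP_iff by auto
  then show ?thesis by auto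
qed

lemma powr_less_of_log2_ereal_less:
  assumes "- log2_ereal s < ereal c"
  shows "ereal (2 powr (- c)) < s"
proof (cases s)
  case (real v)
  with assms have v: "v > 0" "- log 2 v < c"
    by (auto simp: log2_ereal_def split: if_splits)
  then have "2 powr (- c) < 2 powr (log 2 v)" by (intro powr_less_mono) auto
  also have "\<dots> = v" using v(1) by (intro powr_log_cancel) auto
  finally show ?thesis using real by simp
qed (use assms in \<open>auto simp: log2_ereal_def\<close>)

lemma log2_ereal_le:
  assumes "s \<le> ereal R" and "R > 0"
  shows "log2_ereal s \<le> ereal (log 2 R)"
proof (cases s)
  case (real v)
  then show ?thesis using assms by (auto simp: log2_ereal_def intro!: log_mono)
qed (use assms in \<open>auto simp: log2_ereal_def\<close>)

lemma covering_number_pos: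
  fixes F :: "'a::metric_space set"
  assumes "compact (UNIV :: 'a set)" and "F \<noteq> {}" and "\<rho> > 0"
  shows "covering_number \<rho> F \<ge> 1"
proof -
  obtain C where "finite C" "card C = covering_number \<rho> F" "F \<subseteq> (\<Union>c\<in>C. ball c \<rho>)"
    using covering_number_attained[OF assms(1,3)] by blast
  with assms(2) show ?thesis by (cases "C = {}") (auto simp: Suc_le_eq card_gt_0_iff)
qed

lemma upper_box_dim_nonneg:
  fixes F :: "'a::metric_space set"
  assumes "compact (UNIV :: 'a set)" and "F \<noteq> {}"
  shows "upper_box_dim F \<ge> 0"
  unfolding upper_box_dim_def
proof (rule le_Limsup)
  have "\<forall>\<^sub>F \<delta> in at_right (0::real). \<delta> \<in> {0<..<1}" by (rule eventually_at_right_real) simp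
  then show "\<forall>\<^sub>F \<delta> in at_right 0. 0 \<le> ereal (log 2 (real (covering_number \<delta> F)) / - log 2 \<delta>)"
  proof eventually_elim
    case (elim \<delta>)
    then have "log 2 (real (covering_number \<delta> F)) \<ge> 0"
      using covering_number_pos[OF assms, of \<delta>] by simp
    moreover have "- log 2 \<delta> \<ge> 0" using elim by simp
    ultimately show ?case by (simp add: divide_nonneg_nonpos)
  qed
qed simp

lemma upper_box_dim_singleton: "upper_box_dim {x :: 'a::metric_space} = 0"
proof -
  have "covering_number \<delta> {x} = 1" if "\<delta> > 0" for \<delta>
    unfolding covering_number_def
  proof (rule Least_equality)
    show "\<exists>C. finite C \<and> card C = 1 \<and> {x} \<subseteq> (\<Union>c\<in>C. ball c \<delta>)"
      by (rule exI[of _ "{x}"]) (use that in auto)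
    fix n assume "\<exists>C. finite C \<and> card C = n \<and> {x} \<subseteq> (\<Union>c\<in>C. ball c \<delta>)"
    then show "1 \<le> n" by (auto simp: Suc_le_eq card_gt_0_iff)
  qed
  then have "\<forall>\<^sub>F \<delta> in at_right 0. ereal (log 2 (real (covering_number \<delta> {x})) / - log 2 \<delta>) = 0"
    using eventually_at_right_less[of "0::real"] by (auto elim: eventually_mono)
  then have "upper_box_dim {x} = Limsup (at_right (0::real)) (\<lambda>_. 0)"
    unfolding upper_box_dim_def by (rule Limsup_eq)
  then show ?thesis by (simp add: Limsup_const)
qed

lemma eventually_covering_number_dyadic:
  assumes "upper_box_dim F < ereal d"
  shows "\<forall>\<^sub>F j in sequentially. log 2 (real (covering_number ((1 / 2) ^ (j + k)) F)) < d * real (j + k)"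
proof -
  have "\<forall>\<^sub>F \<delta> in at_right 0. ereal (log 2 (real (covering_number \<delta> F)) / - log 2 \<delta>) < ereal d"
    using assms unfolding upper_box_dim_def by (rule Limsup_lessD)
  moreover have "filterlim (\<lambda>j. (1 / 2 :: real) ^ (j + k)) (at_right 0) sequentially"
    unfolding filterlim_at by (auto intro!: LIMSEQ_ignore_initial_segment LIMSEQ_realpow_zero)
  ultimately have "\<forall>\<^sub>F j in sequentially.
      ereal (log 2 (real (covering_number ((1 / 2) ^ (j + k)) F)) / - log 2 ((1 / 2) ^ (j + k))) < ereal d"
    by (rule eventually_compose_filterlim)
  then show ?thesis
    using eventually_gt_at_top[of 0]
  proof eventually_elim
    case (elim j)
    have "- log 2 ((1 / 2) ^ (j + k)) = real (j + k)"
      by (subst log_nat_power) (auto simp: log_divide)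
    with elim show ?case by (simp add: divide_less_eq)
  qed
qed

text \<open>
  If \<open>z \<noteq> x\<close>, then \<open>z\<close> lies outside every dynamical ball about \<open>x\<close> with
  \<open>\<epsilon> < dist x z\<close>, so the sensitivity radius stays bounded. Hence the sensitivity can be
  negative, namely \<open>-\<infinity>\<close>, only if the space is a single point.
\<close>

lemma sensitivity_nonneg:
  fixes x z :: "'a::metric_space"
  assumes f: "filterlim f at_top sequentially" and "z \<noteq> x"
  shows "sensitivity f T x \<ge> 0"
proof -
  let ?R = "dist x z"
  have R: "?R > 0" using assms(2) by simp
  have radius: "sens_radius T x n (?R / 2) \<le> ereal ?R" for n
    unfolding sens_radius_def
  proof (rule SUP_least)
    fix r assume "r \<in> {r. ball x r \<subseteq> dyn_ball T n x (?R / 2)}"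
    moreover have "z \<notin> dyn_ball T n x (?R / 2)"
      using R by (auto simp: dyn_ball_def dist_commute intro!: exI[of _ 0])
    ultimately show "ereal r \<le> ereal ?R" by (auto simp: subset_iff not_less)
  qed
  have "(\<lambda>n. - log 2 ?R / f n) \<longlonglongrightarrow> 0"
    by (rule real_tendsto_divide_at_top[OF tendsto_const f])
  then have "limsup (\<lambda>n. ereal (- log 2 ?R / f n)) = ereal 0"
    by (intro lim_imp_Limsup) auto
  moreover have "limsup (\<lambda>n. ereal (- log 2 ?R / f n)) \<le> sensitivity_at f T (?R / 2) x"
    unfolding sensitivity_at_def
  proof (rule Limsup_mono)
    have "\<forall>\<^sub>F n in sequentially. f n > 0" using f by (rule filterlim_at_top_dense[THEN iffD1, rule_format])
    then show "\<forall>\<^sub>F n in sequentially.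
        ereal (- log 2 ?R / f n) \<le> - log2_ereal (sens_radius T x n (?R / 2)) / ereal (f n)"
    proof eventually_elim
      case (elim n)
      have "ereal (- log 2 ?R) \<le> - log2_ereal (sens_radius T x n (?R / 2))"
        using log2_ereal_le[OF radius R, of n] ereal_minus_le_minus by fastforce
      then have "ereal (- log 2 ?R) / ereal (f n)
          \<le> - log2_ereal (sens_radius T x n (?R / 2)) / ereal (f n)"
        using elim by (intro ereal_divide_right_mono) auto
      then show ?case using elim by simp
    qed
  qed
  moreover have "sensitivity_at f T (?R / 2) x \<le> sensitivity f T x"
    unfolding sensitivity_def using R by (intro SUP_upper) auto
  ultimately show ?thesis by (metis order_trans zero_ereal_def)
qed

section \<open>The complexity inequality\<close>

text \<open>
  Choose \<open>j n\<close> as \<open>r * f n\<close> rounded up. As \<open>r\<close> exceeds the sensitivity, the ball of radius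
  \<open>2^-(j n)\<close> eventually lies in the dynamical ball; as \<open>j n\<close> tends to infinity and \<open>d\<close>
  exceeds the box dimension, the logarithm of the covering number is eventually below
  \<open>d * (j n + 6)\<close>. The bound of \<open>itinerary_complexity_bound\<close>, divided by \<open>f n\<close>, then
  tends to \<open>d * r + a\<close>.
\<close>

lemma cover_complexity_le:
  assumes "\<epsilon> > 0"
    and bound: "\<And>n j. ball x ((1 / 2) ^ j) \<subseteq> dyn_ball T n x \<epsilon> \<Longrightarrow>
      \<exists>\<omega>\<in>itineraries T \<beta> x. real (word_AIC U E (length \<beta>) (prefix_word \<omega> n)) \<le>
        c + log 2 (real (covering_number ((1 / 2) ^ (j + 6)) F)) + log 2 (2 * real n + 1)
          + 4 * log 2 (real j + log 2 (2 * real n + 1) + 1)"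
    and f: "filterlim f at_top sequentially"
    and a: "(\<lambda>n. log 2 (real n) / f n) \<longlonglongrightarrow> a" "a \<ge> 0"
    and d: "upper_box_dim F < ereal d" "d > 0"
    and r: "sensitivity f T x < ereal r" "r > 0"
  shows "cover_complexity U E f T \<beta> x \<le> ereal (d * r + a)"
proof -
  define j where "j n = nat \<lceil>r * f n\<rceil>" for n
  define B where "B n = c + d * (r * f n + 7) + (2 + log 2 (real n)) + 4 * log 2 ((r + a + 1) * f n + 4)" for n
  have f_pos: "\<forall>\<^sub>F n in sequentially. f n > 0"
    using f by (rule filterlim_at_top_dense[THEN iffD1, rule_format])
  have "filterlim (\<lambda>n. r * f n) at_top sequentially"
    using f r(2) by (simp add: filterlim_tendsto_pos_mult_at_top[OF tendsto_const])
  then have "filterlim j at_top sequentially"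
    unfolding filterlim_sequentially_iff_filterlim_real
    by (rule filterlim_at_top_mono) (simp add: j_def real_nat_ceiling_ge)
  then have cov: "\<forall>\<^sub>F n in sequentially.
      log 2 (real (covering_number ((1 / 2) ^ (j n + 6)) F)) < d * real (j n + 6)"
    using eventually_covering_number_dyadic[OF d(1), of 6] by (rule eventually_compose_filterlim[rotated])
  have "sensitivity_at f T \<epsilon> x \<le> sensitivity f T x"
    unfolding sensitivity_def using assms(1) by (intro SUP_upper) auto
  then have "sensitivity_at f T \<epsilon> x < ereal r" using r(1) by (rule order_le_less_trans)
  then have sens: "\<forall>\<^sub>F n in sequentially. - log2_ereal (sens_radius T x n \<epsilon>) / ereal (f n) < ereal r"
    unfolding sensitivity_at_def by (rule Limsup_lessD)
  have log_n: "\<forall>\<^sub>F n in sequentially. log 2 (real n) / f n < a + 1"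
    using a(1) by (rule order_tendstoD) simp
  have "\<forall>\<^sub>F n in sequentially.
      (INF \<omega>\<in>itineraries T \<beta> x. ereal (real (word_AIC U E (length \<beta>) (prefix_word \<omega> n)) / f n))
      \<le> ereal (B n / f n)"
    using f_pos cov sens log_n eventually_ge_at_top[of 1]
  proof eventually_elim
    case (elim n)
    have "- log2_ereal (sens_radius T x n \<epsilon>) < ereal (r * f n)"
      using elim(1,3) by (cases "log2_ereal (sens_radius T x n \<epsilon>)") (auto simp: field_simps)
    then have rad: "ereal (2 powr (- (r * f n))) < sens_radius T x n \<epsilon>"
      by (rule powr_less_of_log2_ereal_less)
    have "r * f n > 0" using elim(1) r(2) by simp
    then have j: "r * f n \<le> real (j n)" "real (j n) \<le> r * f n + 1"
      unfolding j_def by linarith+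
    have "(1 / 2) ^ j n = 2 powr (- real (j n))"
      by (simp add: powr_minus powr_realpow power_one_over inverse_eq_divide)
    also have "\<dots> \<le> 2 powr (- (r * f n))" using j(1) by simp
    finally have "ball x ((1 / 2) ^ j n) \<subseteq> dyn_ball T n x \<epsilon>"
      by (intro ball_subset_dyn_ball_of_less_sens_radius order_le_less_trans[OF _ rad]) simp
    then obtain \<omega> where \<omega>: "\<omega> \<in> itineraries T \<beta> x"
      "real (word_AIC U E (length \<beta>) (prefix_word \<omega> n)) \<le>
        c + log 2 (real (covering_number ((1 / 2) ^ (j n + 6)) F)) + log 2 (2 * real n + 1)
          + 4 * log 2 (real (j n) + log 2 (2 * real n + 1) + 1)"
      using bound by blast
    have n: "log 2 (2 * real n + 1) \<le> 2 + log 2 (real n)"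
    proof -
      have "log 2 (2 * real n + 1) \<le> log 2 (4 * real n)" using elim(5) by (intro log_mono) auto
      also have "\<dots> = log 2 4 + log 2 (real n)" using elim(5) by (simp add: log_mult)
      also have "log 2 (4 :: real) = 2" using log_pow_cancel[of 2 2] by simp
      finally show ?thesis .
    qed
    have "log 2 (real n) \<le> (a + 1) * f n" using elim(1,4) by (simp add: divide_less_eq)
    then have "real (j n) + log 2 (2 * real n + 1) + 1 \<le> (r + a + 1) * f n + 4"
      using n j(2) by (simp add: algebra_simps)
    then have "log 2 (real (j n) + log 2 (2 * real n + 1) + 1) \<le> log 2 ((r + a + 1) * f n + 4)"
      using elim(5) by (intro log_mono) (auto intro: add_nonneg_pos add_nonneg_nonneg)
    moreover have "d * real (j n + 6) \<le> d * (r * f n + 7)"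
      using d(2) j(2) by (intro mult_left_mono) auto
    ultimately have "real (word_AIC U E (length \<beta>) (prefix_word \<omega> n)) \<le> B n"
      using \<omega>(2) elim(2) n unfolding B_def by linarith
    then have "ereal (real (word_AIC U E (length \<beta>) (prefix_word \<omega> n)) / f n) \<le> ereal (B n / f n)"
      using elim(1) by (simp add: divide_right_mono)
    then show ?case by (rule INF_lower2[OF \<omega>(1)])
  qed
  then have "cover_complexity U E f T \<beta> x \<le> limsup (\<lambda>n. ereal (B n / f n))"
    unfolding cover_complexity_def by (rule Limsup_mono)
  also have "\<dots> = ereal (d * r + a)"
  proof (rule lim_imp_Limsup)
    have "((\<lambda>y. log 2 ((r + a + 1) * y + 4) / y) \<longlongrightarrow> 0) at_top"
      using r(2) a(2) unfolding log_def by real_asymp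
    then have loglog: "(\<lambda>n. log 2 ((r + a + 1) * f n + 4) / f n) \<longlonglongrightarrow> 0"
      using f by (rule filterlim_compose)
    have "(\<lambda>n. (c + 7 * d + 2) / f n) \<longlonglongrightarrow> 0"
      by (rule real_tendsto_divide_at_top[OF tendsto_const f])
    then have "(\<lambda>n. (c + 7 * d + 2) / f n + d * r + log 2 (real n) / f n
        + 4 * (log 2 ((r + a + 1) * f n + 4) / f n)) \<longlonglongrightarrow> 0 + d * r + a + 4 * 0"
      by (intro tendsto_intros a(1) loglog)
    moreover have "\<forall>\<^sub>F n in sequentially. (c + 7 * d + 2) / f n + d * r + log 2 (real n) / f n
        + 4 * (log 2 ((r + a + 1) * f n + 4) / f n) = B n / f n"
      using f_pos by eventually_elim (simp add: B_def field_simps)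
    ultimately have "(\<lambda>n. B n / f n) \<longlonglongrightarrow> 0 + d * r + a + 4 * 0"
      by (rule Lim_transform_eventually)
    then show "((\<lambda>n. ereal (B n / f n)) \<longlongrightarrow> ereal (d * r + a)) sequentially" by simp
  qed simp
  finally show ?thesis .
qed

text \<open>
  Passage to the limit in both factors. The infinite cases are where determinacy of the product enters:
  if one factor is infinite, the other is then positive and the right-hand side is infinite. A
  negative \<open>r\<close> comes with \<open>d = 0\<close>, and the product is \<open>0\<close> as for \<open>r = 0\<close>.
\<close>

lemma le_of_all_larger_factors:
  fixes d r K :: ereal
  assumes "\<And>d' r'. d < ereal d' \<Longrightarrow> 0 < d' \<Longrightarrow> r < ereal r' \<Longrightarrow> 0 < r' \<Longrightarrow> K \<le> ereal (d' * r' + a)"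
    and "d \<ge> 0" and "r < 0 \<Longrightarrow> d = 0" and "determinate_product d r"
  shows "K \<le> d * r + ereal a"
proof (cases "r < 0")
  case True
  then have "d = 0" using assms(3) by simp
  have "K \<le> ereal a"
  proof (rule ereal_le_epsilon2)
    fix e :: real assume "e > 0"
    then have "K \<le> ereal (e * 1 + a)"
      using True \<open>d = 0\<close> by (intro assms(1)) (auto intro: less_trans[of r 0])
    then show "K \<le> ereal a + ereal e" by (simp add: add.commute)
  qed
  with \<open>d = 0\<close> show ?thesis by simp
next
  case False
  then have "r \<ge> 0" by simp
  show ?thesis
  proof (cases "d = \<infinity> \<or> r = \<infinity>")
    case True
    then have "d > 0" "r > 0"
      using assms(2,4) \<open>r \<ge> 0\<close> by (auto simp: determinate_product_def less_le)
    with True have "d * r = \<infinity>" by auto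
    show ?thesis unfolding \<open>d * r = \<infinity>\<close> by simp
  next
    case False
    with assms(2) \<open>r \<ge> 0\<close> obtain u v where uv: "d = ereal u" "r = ereal v" "u \<ge> 0" "v \<ge> 0"
      by (cases d; cases r) auto
    have "((\<lambda>e. ereal ((u + e) * (v + e) + a)) \<longlongrightarrow> ereal ((u + 0) * (v + 0) + a)) (at_right 0)"
      by (intro tendsto_intros)
    moreover have "\<forall>\<^sub>F e in at_right 0. K \<le> ereal ((u + e) * (v + e) + a)"
      using eventually_at_right_less[of "0::real"]
      by eventually_elim (rule assms(1); use uv in simp)
    ultimately have "K \<le> ereal ((u + 0) * (v + 0) + a)"
      by (rule tendsto_lowerbound) simp
    then show ?thesis by (simp add: uv)
  qed
qed

text \<open>
  The common form of all four inequalities: \<open>F\<close> contains a sequence of points, computable from the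
  ideal points, that accumulates at \<open>x\<close>, and \<open>f\<close> grows at least as fast as a multiple of the
  logarithm, with \<open>l\<close> the limit of \<open>log n / f n\<close>.
\<close>

lemma orbit_complexity_le:
  fixes F :: "'a::metric_space set" and T :: "'a \<Rightarrow> 'a"
  assumes "recursive_enumeration A" and "universal_machine A U" and "word_encoding E"
    and cpt: "compact (UNIV :: 'a set)"
    and "computable_interpretation I" "I \<in> \<I>" and "constructive \<I> T"
    and "total_recursive 1 (\<lambda>xs. a (xs ! 0))" and "total_recursive 1 (\<lambda>xs. b (xs ! 0))"
    and "\<And>t. y t = (T ^^ a t) (I (str_decode (b t)))"
    and F: "range y \<subseteq> F" and "x \<in> closure (range y)"
    and f: "filterlim f at_top sequentially"
    and l: "(\<lambda>n. log 2 (real n) / f n) \<longlonglongrightarrow> l" "l \<ge> 0"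
    and "determinate_product (upper_box_dim F) (sensitivity f T x)"
  shows "orbit_complexity U E f T x \<le> upper_box_dim F * sensitivity f T x + ereal l"
proof (rule le_of_all_larger_factors)
  have "F \<noteq> {}" using F by auto
  with cpt show "upper_box_dim F \<ge> 0" by (rule upper_box_dim_nonneg)
  show "upper_box_dim F = 0" if "sensitivity f T x < 0"
  proof -
    have all: "z = x" for z using sensitivity_nonneg[OF f, of z x T] that by (metis not_le)
    obtain z where "z \<in> F" using \<open>F \<noteq> {}\<close> by blast
    then have "x \<in> F" unfolding all[of z] .
    with all have "F = {x}" by auto
    then show ?thesis by (simp add: upper_box_dim_singleton)
  qed
  fix d r assume dr: "upper_box_dim F < ereal d" "0 < d" "sensitivity f T x < ereal r" "0 < r"
  show "orbit_complexity U E f T x \<le> ereal (d * r + l)"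
    unfolding orbit_complexity_def
  proof (rule SUP_least)
    fix \<beta> :: "'a set list" assume "\<beta> \<in> Collect finite_open_cover"
    then have "finite_open_cover \<beta>" by simp
    then show "cover_complexity U E f T \<beta> x \<le> ereal (d * r + l)"
    proof (rule itinerary_complexity_bound[OF assms(1-12)])
      fix c \<epsilon> :: real
      assume "\<epsilon> > 0" and "\<And>n j. ball x ((1 / 2) ^ j) \<subseteq> dyn_ball T n x \<epsilon> \<Longrightarrow>
        \<exists>\<omega>\<in>itineraries T \<beta> x. real (word_AIC U E (length \<beta>) (prefix_word \<omega> n)) \<le>
          c + log 2 (real (covering_number ((1 / 2) ^ (j + 6)) F)) + log 2 (2 * real n + 1)
            + 4 * log 2 (real j + log 2 (2 * real n + 1) + 1)"
      then show ?thesis by (rule cover_complexity_le[OF _ _ f l dr])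
    qed
  qed
qed fact

theorem theorem40:
  fixes A :: "nat \<Rightarrow> str \<Rightarrow> str option"
    and U :: "str \<Rightarrow> str option"
    and E :: "nat \<Rightarrow> nat list \<Rightarrow> str"
    and \<I> :: "(str \<Rightarrow> 'a::metric_space) set"
    and T :: "'a \<Rightarrow> 'a"
    and x :: 'a
    and f :: "nat \<Rightarrow> real"
  assumes "recursive_enumeration A"
    and "universal_machine A U"
    and "word_encoding E"
    and "compact (UNIV :: 'a set)"
    and "computable_structure \<I>"
    and "constructive \<I> T"
    and "mono f"
    and "filterlim f at_top sequentially"
  shows
    "((\<lambda>n. log 2 (real n)) \<in> o(f) \<longrightarrow>
        determinate_product (upper_box_dim (UNIV :: 'a set)) (sensitivity f T x) \<longrightarrow>
        orbit_complexity U E f T x \<le> upper_box_dim (UNIV :: 'a set) * sensitivity f T x)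
     \<and>
     (determinate_product (upper_box_dim (UNIV :: 'a set))
          (sensitivity (\<lambda>n. log 2 (real n)) T x) \<longrightarrow>
        orbit_complexity U E (\<lambda>n. log 2 (real n)) T x
          \<le> upper_box_dim (UNIV :: 'a set) * sensitivity (\<lambda>n. log 2 (real n)) T x + 1)
     \<and>
     (\<forall>I\<in>\<I>. \<forall>s\<^sub>0. x \<in> closure (orbit T (I s\<^sub>0)) \<longrightarrow>
        ((\<lambda>n. log 2 (real n)) \<in> o(f) \<longrightarrow>
          determinate_product (upper_box_dim (closure (orbit T (I s\<^sub>0)))) (sensitivity f T x) \<longrightarrow>
          orbit_complexity U E f T x
            \<le> upper_box_dim (closure (orbit T (I s\<^sub>0))) * sensitivity f T x)
        \<and>
        (determinate_product (upper_box_dim (closure (orbit T (I s\<^sub>0))))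
            (sensitivity (\<lambda>n. log 2 (real n)) T x) \<longrightarrow>
          orbit_complexity U E (\<lambda>n. log 2 (real n)) T x
            \<le> upper_box_dim (closure (orbit T (I s\<^sub>0)))
                * sensitivity (\<lambda>n. log 2 (real n)) T x + 1))"
proof -
  let ?log = "\<lambda>n. log 2 (real n)"
  obtain I0 where I0: "computable_interpretation I0" "\<I> = interpretation_equiv `` {I0}"
    using assms(5) by (auto simp: computable_structure_def quotient_def)
  then have I0_mem: "I0 \<in> \<I>"
    by (simp add: interpretation_equiv_def computable_interpretation_def)
  have interp: "computable_interpretation I" if "I \<in> \<I>" for I
    using that I0(2) by (simp add: interpretation_equiv_def)
  have log_f: "(\<lambda>n. ?log n / f n) \<longlonglongrightarrow> 0" if "?log \<in> o(f)"
    using that by (rule smalloD_tendsto)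
  have log_top: "filterlim ?log at_top sequentially" unfolding log_def by real_asymp
  have log_log: "(\<lambda>n. ?log n / ?log n) \<longlonglongrightarrow> 1"
  proof (rule tendsto_eventually)
    show "\<forall>\<^sub>F n in sequentially. ?log n / ?log n = 1"
      using eventually_gt_at_top[of 1] 
    proof eventually_elim
      case (elim n)
      then have "?log n > 0" by simp
      then show ?case by simp
    qed
  qed
  have recursive_id: "total_recursive 1 (\<lambda>xs. xs ! 0)" by (rule recursive_nth) simp

  have x0: "x \<in> closure (range (\<lambda>t. I0 (str_decode t)))"
    using dense_ideal_points[OF I0(1)] by (auto simp: closure_approachable dist_commute)
  note whole = orbit_complexity_le[OF assms(1-4) I0(1) I0_mem assms(6) recursive_const[of 1 0] recursive_id
      _ subset_UNIV x0, simplified]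
  have orbit: "orbit_complexity U E g T x
      \<le> upper_box_dim (closure (orbit T (I s))) * sensitivity g T x + ereal l"
    if "I \<in> \<I>" "x \<in> closure (orbit T (I s))" "filterlim g at_top sequentially"
      "(\<lambda>n. ?log n / g n) \<longlonglongrightarrow> l" "l \<ge> 0"
      "determinate_product (upper_box_dim (closure (orbit T (I s)))) (sensitivity g T x)" for I s g l
  proof (rule orbit_complexity_le[OF assms(1-4) interp[OF that(1)] that(1) assms(6) recursive_id
        recursive_const[of 1 "str_code s"] _ _ _ that(3-6)])
    show "(T ^^ t) (I s) = (T ^^ t) (I (str_decode (str_code s)))" for t by simp
  qed (use that(2) in \<open>auto simp: orbit_def closure_subset[THEN subsetD]\<close>)
  show ?thesis
    using whole[OF assms(8) log_f] whole[OF log_top log_log] orbit[OF _ _ assms(8) log_f]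
      orbit[OF _ _ log_top log_log]
    by (auto simp: one_ereal_def)
qed

end
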